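(* Let $b,\ell$ be two sufficiently large integers. There is a map $\psi_{b,\ell}:\{0,1\}^{b\cdot\ell}\to\mathbb{Z}^\ell$ and a set $V_{b,\ell}\subseteq\mathbb{Z}$ such that for every $x,y\in\{0,1\}^{b\cdot\ell}$, \[ x\cdot y = 0 \iff \psi_{b,\ell}(x)\cdot\psi_{b,\ell}(y)\in V_{b,\ell}, \] and $0\le \psi_{b,\ell}(x)_i < \ell^{6^{\log^*(b)}\cdot b}$ for all $x$ and all $i\in[\ell]$. Moreover, $\psi_{b,\ell}(x)$ can be computed in $\mathrm{poly}(b\cdot\ell)$ time, and $V_{b,\ell}$ can be constructed in $O\left(\ell^{O(6^{\log^*(b)}\cdot b)}\cdot\mathrm{poly}(b\cdot\ell)\right)$ time.
   Context: $\log^*$ is the iterated logarithm: $\log^*(n)=0$ if $n\le1$ and $\log^*(n)=\log^*(\log n)+1$ otherwise ($\log$ base 2). $[\ell]=\{1,\dots,\ell\}$. *)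

theory Defs
  imports Complex_Main "HOL-Library.FuncSet" "HOL-Library.Log_Nat" "HOL-Computational_Algebra.Polynomial"
begin

section \<open>The iterated logarithm\<close>

lemma log2_le_minus_quarter:
  fixes x :: real
  assumes "x > 1"
  shows "log 2 x \<le> x - 1/4"
proof -
  define y where "y = x * ln 2"
  have "ln (2::real) = - ln (3/4) - ln (2/3)" using ln_realpow[of "2::real" 2] by (simp add: ln_div)
  then have l: "ln (2::real) \<ge> 7/12"
    using ln_le_minus_one[of "3/4::real"] ln_le_minus_one[of "2/3::real"] by simp
  have "ln y \<le> y - 1" using assms l by (intro ln_le_minus_one) (simp add: y_def)
  moreover have "ln y = ln x + ln (ln 2)" using assms l by (simp add: y_def ln_mult)
  moreover have "ln (ln (2::real)) \<ge> ln (7/12)" using l by (subst ln_le_cancel_iff) auto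
  moreover have "ln (7/12::real) \<ge> - 5/7"
    using ln_le_minus_one[of "12/7::real"] by (simp add: ln_div)
  ultimately have "ln x \<le> x * ln 2 - 1/4" unfolding y_def by linarith
  also have "\<dots> \<le> (x - 1/4) * ln 2" using ln_2_less_1 by (simp add: algebra_simps)
  finally show ?thesis by (simp add: log_def divide_le_eq)
qed

function log_star :: "real \<Rightarrow> nat" where
  "log_star x = (if x \<le> 1 then 0 else log_star (log 2 x) + 1)"
  by pat_completeness auto
termination
proof (relation "measure (\<lambda>x. nat \<lceil>4 * x\<rceil>)")
  fix x :: real
  assume "\<not> x \<le> 1"
  then have "4 * log 2 x \<le> 4 * x - 1" and "4 * x > 0"
    using log2_le_minus_quarter[of x] by auto
  then have "\<lceil>4 * log 2 x\<rceil> < \<lceil>4 * x\<rceil>" "0 < \<lceil>4 * x\<rceil>" by linarith+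
  then show "(log 2 x, x) \<in> measure (\<lambda>x. nat \<lceil>4 * x\<rceil>)" by simp
qed simp

declare log_star.simps [simp del]

section \<open>Integer vectors\<close>

definition vecs :: "int set \<Rightarrow> nat \<Rightarrow> int list set" where
  "vecs A n = {x. length x = n \<and> set x \<subseteq> A}"

definition dot :: "int list \<Rightarrow> int list \<Rightarrow> int" where
  "dot x y = (\<Sum>i<length x. x ! i * y ! i)"

section \<open>Computation model: a random access machine with logarithmic cost\<close>

text \<open>
  Programs are while programs over integer memory cells. Every variable name denotes an array
  indexed by the integers; a scalar is the cell at index 0. Cells hold integers of arbitrary size,
  so every operation is charged by the bit length of the numbers (values and addresses) that it
  touches; multiplication, division and remainder are charged as in the schoolbook algorithms.
  Running times in this model and on multitape Turing machines are polynomially related.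
\<close>

type_synonym vname = string
type_synonym state = "vname \<Rightarrow> int \<Rightarrow> int"

datatype aexp =
    Num int
  | Cell vname aexp
  | Add aexp aexp
  | Sub aexp aexp
  | Mul aexp aexp
  | Quot aexp aexp
  | Rem aexp aexp

datatype bexp =
    Less aexp aexp
  | Equal aexp aexp
  | Neg bexp
  | Conj bexp bexp

datatype com =
    Skip
  | Assign vname aexp aexp
  | Seq com com
  | If bexp com com
  | While bexp com

fun aval :: "aexp \<Rightarrow> state \<Rightarrow> int" where
  "aval (Num n) s = n"
| "aval (Cell x e) s = s x (aval e s)"
| "aval (Add e f) s = aval e s + aval f s"
| "aval (Sub e f) s = aval e s - aval f s"
| "aval (Mul e f) s = aval e s * aval f s"
| "aval (Quot e f) s = aval e s div aval f s"
| "aval (Rem e f) s = aval e s mod aval f s"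

fun bval :: "bexp \<Rightarrow> state \<Rightarrow> bool" where
  "bval (Less e f) s \<longleftrightarrow> aval e s < aval f s"
| "bval (Equal e f) s \<longleftrightarrow> aval e s = aval f s"
| "bval (Neg p) s \<longleftrightarrow> \<not> bval p s"
| "bval (Conj p q) s \<longleftrightarrow> bval p s \<and> bval q s"

text \<open>The extra bit is the sign; it also makes the size of 0 positive.\<close>

definition bit_size :: "int \<Rightarrow> nat" where
  "bit_size n = floorlog 2 (nat \<bar>n\<bar>) + 1"

fun acost :: "aexp \<Rightarrow> state \<Rightarrow> nat" where
  "acost (Num n) s = bit_size n"
| "acost (Cell x e) s = acost e s + bit_size (aval e s) + bit_size (aval (Cell x e) s)"
| "acost (Add e f) s = acost e s + acost f s + bit_size (aval e s) + bit_size (aval f s)"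
| "acost (Sub e f) s = acost e s + acost f s + bit_size (aval e s) + bit_size (aval f s)"
| "acost (Mul e f) s = acost e s + acost f s + bit_size (aval e s) * bit_size (aval f s)"
| "acost (Quot e f) s = acost e s + acost f s + bit_size (aval e s) * bit_size (aval f s)"
| "acost (Rem e f) s = acost e s + acost f s + bit_size (aval e s) * bit_size (aval f s)"

fun bcost :: "bexp \<Rightarrow> state \<Rightarrow> nat" where
  "bcost (Less e f) s = acost e s + acost f s + bit_size (aval e s) + bit_size (aval f s)"
| "bcost (Equal e f) s = acost e s + acost f s + bit_size (aval e s) + bit_size (aval f s)"
| "bcost (Neg p) s = bcost p s + 1"
| "bcost (Conj p q) s = bcost p s + bcost q s + 1"

text \<open>
  \<open>exec c s t s'\<close>: started in state \<open>s\<close>, the program \<open>c\<close> halts in state \<open>s'\<close> after time \<open>t\<close>.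
  \<open>Assign x e f\<close> stores the value of \<open>f\<close> in cell \<open>e\<close> of the array \<open>x\<close>.
\<close>

inductive exec :: "com \<Rightarrow> state \<Rightarrow> nat \<Rightarrow> state \<Rightarrow> bool" where
  Skip: "exec Skip s 1 s"
| Assign: "exec (Assign x e f) s
      (acost e s + acost f s + bit_size (aval e s) + bit_size (aval f s))
      (s(x := (s x)(aval e s := aval f s)))"
| Seq: "exec c s t s' \<Longrightarrow> exec d s' u s'' \<Longrightarrow> exec (Seq c d) s (t + u) s''"
| IfTrue: "bval p s \<Longrightarrow> exec c s t s' \<Longrightarrow> exec (If p c d) s (bcost p s + t) s'"
| IfFalse: "\<not> bval p s \<Longrightarrow> exec d s t s' \<Longrightarrow> exec (If p c d) s (bcost p s + t) s'"
| WhileFalse: "\<not> bval p s \<Longrightarrow> exec (While p c) s (bcost p s) s"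
| WhileTrue: "bval p s \<Longrightarrow> exec c s t s' \<Longrightarrow> exec (While p c) s' u s'' \<Longrightarrow>
      exec (While p c) s (bcost p s + t + u) s''"

inductive_cases SkipE: "exec Skip s t s'"
inductive_cases AssignE: "exec (Assign x e f) s t s'"
inductive_cases SeqE: "exec (Seq c d) s t s'"
inductive_cases IfE: "exec (If p c d) s t s'"
inductive_cases WhileE: "exec (While p c) s t s'"

lemma exec_deterministic:
  "exec c s t s' \<Longrightarrow> exec c s u s'' \<Longrightarrow> u = t \<and> s'' = s'"
proof (induction arbitrary: u s'' rule: exec.induct)
  case (Skip s)
  from Skip.prems show ?case by - (erule SkipE; simp)
next
  case (Assign x e f s)
  from Assign.prems show ?case by - (erule AssignE; simp)
next
  case (Seq c s t s1 d t' s2)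
  from Seq.prems show ?case by - (erule SeqE; auto dest!: Seq.IH)
next
  case (IfTrue p s c t s1 d)
  from IfTrue.prems IfTrue.hyps(1) show ?case by - (erule IfE; auto dest!: IfTrue.IH)
next
  case (IfFalse p s d t s1 c)
  from IfFalse.prems IfFalse.hyps(1) show ?case by - (erule IfE; auto dest!: IfFalse.IH)
next
  case (WhileFalse p s c)
  from WhileFalse.prems WhileFalse.hyps show ?case by - (erule WhileE; simp)
next
  case (WhileTrue p s c t s1 t' s2)
  from WhileTrue.prems WhileTrue.hyps(1) show ?case
    by - (erule WhileE; auto dest!: WhileTrue.IH)
qed

text \<open>Cells outside of the given input lists are initially 0.\<close>

definition input_state :: "(vname \<Rightarrow> int list) \<Rightarrow> state" where
  "input_state inp x i = (if 0 \<le> i \<and> i < int (length (inp x)) then inp x ! nat i else 0)"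

text \<open>
  On halting, the result is the list stored in the array \<open>out\<close>; its length is in cell 0 of \<open>len\<close>.
\<close>

definition outputs_within :: "com \<Rightarrow> (vname \<Rightarrow> int list) \<Rightarrow> int list \<Rightarrow> nat \<Rightarrow> bool" where
  "outputs_within c inp res T \<longleftrightarrow>
     (\<exists>t s. exec c (input_state inp) t s \<and> t \<le> T \<and>
        s ''len'' 0 = int (length res) \<and> (\<forall>i<length res. s ''out'' (int i) = res ! i))"

end

theory Submission
  imports Defs "HOL-Number_Theory.Cong" "HOL-Library.Infinite_Set"
begin

text \<open>
  In each coordinate the \<open>b\<close> bits are combined level by level. If inner products of codes for blocks of
  \<open>t\<close> bits are less than \<open>K\<close>, a group of at most \<open>2 ^ t\<close> such codes is replaced by the solution of the
  congruences that prescribe them modulo the least powers, at least \<open>K\<close>, of the first primes. An inner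
  product of the new codes then determines, modulo each prime power, an inner product of the old ones;
  so the inner products that decode to zeros only are recognised recursively, and \<open>V\<close> is their set.
  As the \<open>k\<close>-th prime is at most \<open>4 (k + 1)\<^sup>2\<close>, a level essentially doubles the exponent of the bound
  per bit, while the block size grows exponentially; hence there are at most \<open>log_star b\<close> levels and
  the bound is \<open>l\<close> to the power \<open>O(2 ^ log_star b * b)\<close>.
\<close>

section \<open>Many small primes\<close>

text \<open>Solving for all \<open>b\<close> bits at once would use about \<open>b\<close> primes,
  and their size would add a factor of order log b to the exponent. With only \<open>2 ^ t\<close>
  codes of \<open>t\<close> bits the primes stay below \<open>l ^ t\<close>, comparable to the codes
  already present, so a level costs little beyond the squaring that is inherent in an inner product
  of two codes. This squaring produces the factor 2 per level. In the base 6 = 2 * 3 the 3 pays for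
  the constants: the exponent starts at 3 and the last block is below \<open>2 * b\<close>, which
  together give 6, and 6 \<le> 3 ^ L once L \<ge> 2. Powers of small primes serve as moduli because
  the numbers \<open>K\<close> to be separated have polynomially many bits: small primes are found
  by trial division, a power of one exceeds \<open>K\<close> at most by one prime factor, and the
  solution can be lifted one prime factor at a time. What has to be known about primes is thus a
  polynomial bound on the k-th one, which follows from the growth of the common multiples of 1, ...,
  n. For the running times a single bit length \<open>r\<close>, polynomial in \<open>b\<close> and
  \<open>l\<close>, bounds all cells throughout; time is then counted in elementary steps.\<close>

text \<open>The numbers 1 / (n (n-1 choose k)) form Leibniz's harmonic triangle: each entry is a
  difference of two entries with smaller k, and the entries with k = 0 are the 1 / n.\<close>

lemma leibniz_triangle:
  fixes D :: nat
  assumes "\<And>m. 0 < m \<Longrightarrow> m \<le> n \<Longrightarrow> m dvd D" and "k < n"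
  shows "n * (n - 1 choose k) dvd D"
proof -
  have "real D / real (n * (n - 1 choose k)) \<in> \<int>"
    using assms
  proof (induction k arbitrary: n)
    case 0
    then have "n dvd D" by simp
    then obtain c where "D = n * c" ..
    with 0 show ?case by simp
  next
    case (Suc k)
    define m where "m = n - 1"
    \<comment> \<open>Both entries \<open>m choose k\<close> and \<open>m choose Suc k\<close> are
      rational multiples of \<open>a\<close>, which turns the recurrence of the triangle into a
      field identity.\<close>
    define a where "a = real (m - 1 choose k)"
    have n: "n = Suc m" and k: "k < m" using Suc.prems by (auto simp: m_def)
    have a: "a > 0" using k by (simp add: a_def)
    have c1: "real (m choose k) = a * m / (real m - real k)"
      using k binomial_absorb_comp[of m k] by (simp add: a_def field_simps flip: of_nat_mult of_nat_diff)
    have c2: "real (m choose Suc k) = a * m / (real k + 1)"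
      using binomial_absorption[of k m]
      by (simp add: a_def field_simps flip: of_nat_mult of_nat_Suc)
    have "real D / real (n * (n - 1 choose Suc k)) =
        real D / real (m * (m - 1 choose k)) - real D / real (n * (n - 1 choose k))"
      unfolding n of_nat_mult diff_Suc_1 c1 c2 a_def[symmetric] using a k
      by (simp add: divide_simps) (simp add: algebra_simps)
    moreover have "real D / real (m * (m - 1 choose k)) \<in> \<int>"
      by (rule Suc.IH) (use Suc.prems n k in auto)
    moreover have "real D / real (n * (n - 1 choose k)) \<in> \<int>"
      by (rule Suc.IH) (use Suc.prems in auto)
    ultimately show ?case by simp
  qed
  then obtain z where z: "real D / real (n * (n - 1 choose k)) = of_int z" by (elim Ints_cases)
  have "n * (n - 1 choose k) > 0" using assms(2) by simp
  with z have "real D = of_int z * real (n * (n - 1 choose k))" by (simp add: field_simps)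
  then have "int D = z * int (n * (n - 1 choose k))"
    by (metis (mono_tags) of_int_eq_iff of_int_mult of_int_of_nat_eq)
  then show ?thesis by (metis dvd_triv_right int_dvd_int_iff)
qed

text \<open>The \<open>n\<close> numbers \<open>n * (n - 1 choose k)\<close> divide
  \<open>D\<close>, so each is at most \<open>D\<close>; their sum is
  \<open>n * 2 ^ (n - 1)\<close>, so their average is the claimed bound.\<close>

lemma two_power_le_common_multiple:
  fixes D :: nat
  assumes "\<And>m. 0 < m \<Longrightarrow> m \<le> n \<Longrightarrow> m dvd D" and "0 < n" and "0 < D"
  shows "2 ^ (n - 1) \<le> D"
proof -
  have "n * 2 ^ (n - 1) = (\<Sum>k\<le>n - 1. n * (n - 1 choose k))"
    by (simp add: choose_row_sum flip: sum_distrib_left)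
  also have "\<dots> \<le> (\<Sum>k\<le>n - 1. D)"
    using assms by (intro sum_mono dvd_imp_le leibniz_triangle) auto
  also have "\<dots> = n * D" using assms(2) by simp
  finally show ?thesis using assms(2) by simp
qed

text \<open>A weak Chebyshev bound: the least common multiple of 1, ..., \<open>n\<close> has one
  factor per prime up to \<open>n\<close>, and each such prime power is at most
  \<open>n\<close>.\<close>

lemma two_power_le_power_card_primes:
  assumes "0 < (n :: nat)"
  shows "2 ^ (n - 1) \<le> n ^ card {p. prime p \<and> p \<le> n}"
proof -
  define S where "S = {p. prime p \<and> p \<le> n}"
  define ex where "ex p = Max {e. p ^ e \<le> n}" for p
  have fin: "finite S" by (simp add: S_def)
  have exfin: "finite {e. p ^ e \<le> n}" if "p \<in> S" for p
  proof (rule finite_subset)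
    have p: "2 \<le> p" using that prime_ge_2_nat by (auto simp: S_def)
    show "{e. p ^ e \<le> n} \<subseteq> {..n}"
    proof safe
      fix e assume "p ^ e \<le> n"
      moreover have "e < 2 ^ e" by (rule less_exp)
      moreover have "2 ^ e \<le> p ^ e" using p by (intro power_mono) auto
      ultimately show "e \<le> n" by linarith
    qed
  qed simp
  have le: "p ^ ex p \<le> n" if "p \<in> S" for p
  proof -
    have "ex p \<in> {e. p ^ e \<le> n}"
      unfolding ex_def using exfin[OF that] assms by (intro Max_in) (auto intro: exI[of _ 0])
    then show ?thesis by simp
  qed
  \<comment> \<open>The least common multiple of 1, ..., \<open>n\<close>, written by its prime
    factorisation.\<close>
  define D where "D = (\<Prod>p\<in>S. p ^ ex p)"
  have pos: "p ^ ex p > 0" if "p \<in> S" for p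
    using that prime_gt_0_nat by (auto simp: S_def)
  have "m dvd D" if m: "0 < m" "m \<le> n" for m
  proof (rule multiplicity_le_imp_dvd)
    show "m \<noteq> 0" using m by simp
    fix p :: nat assume p: "prime p"
    show "multiplicity p m \<le> multiplicity p D"
    proof (cases "multiplicity p m = 0")
      case False
      then have "p dvd m" by (meson not_dvd_imp_multiplicity_0)
      then have pS: "p \<in> S" using m p by (auto simp: S_def dest: dvd_imp_le)
      have "p ^ multiplicity p m \<le> n"
        using m multiplicity_dvd[of p m] by (meson dvd_imp_le le_trans)
      then have "multiplicity p m \<le> ex p" unfolding ex_def using exfin[OF pS] by (intro Max_ge) auto
      moreover have "p ^ ex p dvd D" unfolding D_def using fin pS by (rule dvd_prodI)
      moreover have "D \<noteq> 0" using pos fin by (auto simp: D_def)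
      ultimately show ?thesis
        using p by (metis multiplicity_geI le_trans not_prime_unit)
    qed simp
  qed
  moreover have "D > 0" unfolding D_def using pos by (intro prod_pos) auto
  ultimately have "2 ^ (n - 1) \<le> D" using assms by (intro two_power_le_common_multiple) auto
  also have "D \<le> (\<Prod>p\<in>S. n)" unfolding D_def using le by (intro prod_mono) auto
  also have "\<dots> = n ^ card S" by simp
  finally show ?thesis by (simp add: S_def)
qed

definition nth_prime :: "nat \<Rightarrow> nat" where
  "nth_prime = enumerate {p. prime p}"

lemma prime_nth_prime: "prime (nth_prime k)"
  using enumerate_in_set[OF primes_infinite] by (simp add: nth_prime_def)

lemma nth_prime_less_iff [simp]: "nth_prime j < nth_prime k \<longleftrightarrow> j < k"
  by (simp add: nth_prime_def primes_infinite)

lemma nth_prime_le_iff [simp]: "nth_prime j \<le> nth_prime k \<longleftrightarrow> j \<le> k"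
  by (simp add: nth_prime_def primes_infinite)

lemma ex_nth_prime: "prime p \<Longrightarrow> \<exists>k. nth_prime k = p"
  using enumerate_Ex[OF primes_infinite, of p] by (auto simp: nth_prime_def)

text \<open>Otherwise at most \<open>k\<close> primes lie up to n = 4 (k + 1)^2, so 2 ^ (n - 1)
  \<le> n ^ k. As n is the square of 2 (k + 1) \<le> 2 ^ (k + 1), this forces n - 1 \<le> 2 k (k +
  1), which is absurd.\<close>

lemma nth_prime_le: "nth_prime k \<le> 4 * (k + 1)\<^sup>2"
proof (rule ccontr)
  define n where "n = 4 * (k + 1)\<^sup>2"
  assume "\<not> nth_prime k \<le> 4 * (k + 1)\<^sup>2"
  then have less: "n < nth_prime k" by (simp add: n_def)
  have "{p. prime p \<and> p \<le> n} \<subseteq> nth_prime ` {..<k}"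
  proof safe
    fix p assume "prime p" "p \<le> n"
    then obtain j where j: "nth_prime j = p" using ex_nth_prime by blast
    with \<open>p \<le> n\<close> less have "nth_prime j < nth_prime k" by simp
    with j show "p \<in> nth_prime ` {..<k}" by auto
  qed
  then have "card {p. prime p \<and> p \<le> n} \<le> card {..<k}"
    by (meson card_image_le card_mono finite_imageI finite_lessThan le_trans)
  then have c: "card {p. prime p \<and> p \<le> n} \<le> k" by simp
  have n: "n > 0" "n = (2 * (k + 1))\<^sup>2" by (simp_all add: n_def power2_eq_square)
  have "2 ^ (n - 1) \<le> n ^ card {p. prime p \<and> p \<le> n}"
    by (rule two_power_le_power_card_primes) (use n in simp)
  also have "\<dots> \<le> n ^ k" using c n(1) by (intro power_increasing) auto
  also have "\<dots> = (2 * (k + 1)) ^ (2 * k)" unfolding n(2) by (simp only: power_mult)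
  also have "\<dots> \<le> (2 ^ (k + 1)) ^ (2 * k)"
  proof (rule power_mono)
    have "k + 1 \<le> 2 ^ k" using less_exp[of k] by (simp add: Suc_le_eq)
    then show "2 * (k + 1) \<le> 2 ^ (k + 1)" by simp
  qed simp
  also have "\<dots> = 2 ^ ((k + 1) * (2 * k))" by (simp only: power_mult)
  finally have "n - 1 \<le> (k + 1) * (2 * k)" by simp
  then show False by (simp add: n_def power2_eq_square algebra_simps)
qed

text \<open>No prime lies strictly between \<open>p\<close> and \<open>nth_prime k\<close>. This
  lets \<open>sweep\<close> find the next prime by testing consecutive numbers.\<close>

lemma prime_Suc_iff_nth_prime:
  assumes "\<And>i. i < k \<Longrightarrow> nth_prime i \<le> p" and "p < nth_prime k"
  shows "prime (Suc p) \<longleftrightarrow> Suc p = nth_prime k"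
proof
  assume "prime (Suc p)"
  then obtain j where j: "nth_prime j = Suc p" using ex_nth_prime by blast
  have "\<not> j < k" using assms(1)[of j] j by auto
  moreover have "nth_prime j \<le> nth_prime k" using assms(2) unfolding j by simp
  then have "j \<le> k" by simp
  ultimately show "Suc p = nth_prime k" using j by simp
qed (metis prime_nth_prime)

section \<open>The encoding\<close>

definition least_exponent :: "nat \<Rightarrow> nat \<Rightarrow> nat" where
  "least_exponent K p = (LEAST e. K \<le> p ^ e)"

definition modulus :: "nat \<Rightarrow> nat \<Rightarrow> nat" where
  "modulus K k = nth_prime k ^ least_exponent K (nth_prime k)"

lemma least_exponent:
  assumes "2 \<le> p"
  shows "K \<le> p ^ least_exponent K p" and "e < least_exponent K p \<Longrightarrow> p ^ e < K"
proof -
  have "K \<le> 2 ^ K" using less_exp[of K] by simp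
  also have "\<dots> \<le> p ^ K" using assms by (rule power_mono) simp
  finally show "K \<le> p ^ least_exponent K p" unfolding least_exponent_def by (rule LeastI)
  show "e < least_exponent K p \<Longrightarrow> p ^ e < K"
    unfolding least_exponent_def using not_less_Least not_le by blast
qed

lemma nth_prime_ge_2: "2 \<le> nth_prime k"
  using prime_nth_prime by (rule prime_ge_2_nat)

lemma le_modulus: "K \<le> modulus K k"
  unfolding modulus_def by (rule least_exponent(1)[OF nth_prime_ge_2])

lemma modulus_pos: "0 < modulus K k"
  unfolding modulus_def using nth_prime_ge_2[of k] by simp

text \<open>With one factor \<open>nth_prime k\<close> less the power would be below
  \<open>K\<close>, so the overshoot is at most one prime.\<close>

lemma modulus_le:
  assumes "0 < K"
  shows "modulus K k \<le> K * nth_prime k"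
proof (cases "least_exponent K (nth_prime k)")
  case 0
  then show ?thesis using assms nth_prime_ge_2[of k] by (simp add: modulus_def Suc_le_eq)
next
  case (Suc e)
  then have "nth_prime k ^ e < K" using least_exponent(2)[OF nth_prime_ge_2, of e K k] by simp
  then show ?thesis by (simp add: modulus_def Suc)
qed

lemma coprime_modulus: "i \<noteq> j \<Longrightarrow> coprime (modulus K i) (modulus K j)"
  unfolding modulus_def using prime_nth_prime
  by (metis coprime_power_left_iff coprime_power_right_iff linorder_neq_iff nth_prime_less_iff
      primes_coprime)

text \<open>The least solution is taken without a range condition; for positive pairwise coprime
  moduli it is the unique solution below their product. In this form zero residues give 0 for
  arbitrary moduli.\<close>

definition crt :: "nat \<Rightarrow> (nat \<Rightarrow> nat) \<Rightarrow> (nat \<Rightarrow> nat) \<Rightarrow> nat" where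
  "crt g q a = (LEAST x. \<forall>k<g. [x = a k] (mod q k))"

lemma
  assumes pos: "\<And>k. k < g \<Longrightarrow> 0 < q k"
    and cop: "\<And>i j. i < g \<Longrightarrow> j < g \<Longrightarrow> i \<noteq> j \<Longrightarrow> coprime (q i) (q j)"
  shows crt_less: "crt g q a < (\<Prod>k<g. q k)"
    and crt_cong: "k < g \<Longrightarrow> [crt g q a = a k] (mod q k)"
    and crt_eqI: "x < (\<Prod>k<g. q k) \<Longrightarrow> (\<And>k. k < g \<Longrightarrow> [x = a k] (mod q k)) \<Longrightarrow> crt g q a = x"
proof -
  let ?P = "\<lambda>x. \<forall>k<g. [x = a k] (mod q k)"
  have ex1: "\<exists>!x. x < (\<Prod>k<g. q k) \<and> (\<forall>k\<in>{..<g}. [x = a k] (mod q k))"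
    using pos cop by (intro chinese_remainder_unique_nat) auto
  then obtain z where z: "z < (\<Prod>k<g. q k)" "?P z" by auto
  have P: "?P (crt g q a)" unfolding crt_def by (rule LeastI[of ?P, OF z(2)])
  have le: "crt g q a \<le> z" unfolding crt_def by (rule Least_le[of ?P, OF z(2)])
  from le z(1) show less: "crt g q a < (\<Prod>k<g. q k)" by simp
  show "k < g \<Longrightarrow> [crt g q a = a k] (mod q k)" using P by simp
  show "crt g q a = x" if "x < (\<Prod>k<g. q k)" "\<And>k. k < g \<Longrightarrow> [x = a k] (mod q k)"
    using ex1 P less that by auto
qed

lemma crt_zero: "crt g q (\<lambda>_. 0) = 0"
  unfolding crt_def by (rule Least_equality) auto

text \<open>A group has at most \<open>2 ^ t\<close> elements, so that the first primes, one per element, stay below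
  \<open>l ^ t\<close> and the moduli stay close to the inner products that they have to separate. The second
  alternative keeps the last block below \<open>2 * b\<close>.\<close>

definition group_exponent :: "nat \<Rightarrow> nat \<Rightarrow> nat" where
  "group_exponent b t = (LEAST e. t \<le> e \<or> b \<le> 2 ^ e * t)"

definition group_size :: "nat \<Rightarrow> nat \<Rightarrow> nat" where
  "group_size b t = 2 ^ group_exponent b t"

text \<open>The number of bits combined in one code of level \<open>i\<close>. Until the cut-off
  near \<open>b\<close> it follows t -> t * 2 ^ t, hence grows at least like a tower of
  twos.\<close>

primrec block :: "nat \<Rightarrow> nat \<Rightarrow> nat" where
  "block b 0 = 1"
| "block b (Suc i) = block b i * group_size b (block b i)"

abbreviation groups :: "nat \<Rightarrow> nat \<Rightarrow> nat" where
  "groups b i \<equiv> group_size b (block b i)"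

text \<open>The argument of \<open>modulus\<close> is \<open>dot_bound b l i\<close> written out,
  because \<open>dot_bound\<close> is itself defined from this function;
  \<open>code_bound_Suc\<close> restores the readable form.\<close>

primrec code_bound :: "nat \<Rightarrow> nat \<Rightarrow> nat \<Rightarrow> nat" where
  "code_bound b l 0 = 2"
| "code_bound b l (Suc i) = (\<Prod>k<groups b i. modulus (l * (code_bound b l i)\<^sup>2) k)"

definition dot_bound :: "nat \<Rightarrow> nat \<Rightarrow> nat \<Rightarrow> nat" where
  "dot_bound b l i = l * (code_bound b l i)\<^sup>2"

text \<open>Bits are indexed by all naturals and padded with zeros, so every group is complete;
  \<open>j\<close> is the position of the block at level \<open>i\<close>.\<close>

primrec code :: "nat \<Rightarrow> nat \<Rightarrow> nat \<Rightarrow> (nat \<Rightarrow> nat) \<Rightarrow> nat \<Rightarrow> nat" where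
  "code b l 0 a j = a j"
| "code b l (Suc i) a j =
     crt (groups b i) (modulus (dot_bound b l i)) (\<lambda>k. code b l i a (j * groups b i + k))"

text \<open>The range condition makes the set finite, hence enumerable; genuine inner products of
  codes always satisfy it.\<close>

primrec zero_code :: "nat \<Rightarrow> nat \<Rightarrow> nat \<Rightarrow> nat \<Rightarrow> bool" where
  "zero_code b l 0 v \<longleftrightarrow> v = 0"
| "zero_code b l (Suc i) v \<longleftrightarrow> v < dot_bound b l (Suc i) \<and>
     (\<forall>k<groups b i. zero_code b l i (v mod modulus (dot_bound b l i) k))"

definition depth :: "nat \<Rightarrow> nat" where
  "depth b = (LEAST i. b \<le> block b i)"

lemma code_bound_Suc:
  "code_bound b l (Suc i) = (\<Prod>k<groups b i. modulus (dot_bound b l i) k)"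
  by (simp add: dot_bound_def)

declare code_bound.simps(2) [simp del]

section \<open>Growth of the blocks and the number of levels\<close>

lemma group_exponent_le: "group_exponent b t \<le> t"
  unfolding group_exponent_def by (rule Least_le) simp

lemma group_exponent_cases: "group_exponent b t = t \<or> b \<le> group_size b t * t"
proof -
  have "t \<le> group_exponent b t \<or> b \<le> 2 ^ group_exponent b t * t"
    unfolding group_exponent_def by (rule LeastI[of _ t]) simp
  then show ?thesis using group_exponent_le[of b t] by (auto simp: group_size_def)
qed

text \<open>Below the least exponent both alternatives of its definition fail, and at it one of them
  holds. The right-hand side is the loop test of \<open>choose_group\<close>.\<close>

lemma less_group_exponent_iff: "e \<le> group_exponent b t \<Longrightarrow> e < group_exponent b t \<longleftrightarrow> e < t \<and> 2 ^ e * t < b"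
proof
  assume "e < group_exponent b t"
  from not_less_Least[OF this[unfolded group_exponent_def]] show "e < t \<and> 2 ^ e * t < b" by auto
next
  assume "e \<le> group_exponent b t" "e < t \<and> 2 ^ e * t < b"
  then show "e < group_exponent b t"
    using group_exponent_cases[of b t] by (cases "e = group_exponent b t") (auto simp: group_size_def)
qed

lemma group_size_pos [simp]: "0 < group_size b t"
  by (simp add: group_size_def)

lemma block_pos [simp]: "0 < block b i"
  by (induction i) auto

lemma group_size_ge_2:
  assumes "0 < t" "t < b"
  shows "2 \<le> group_size b t"
proof -
  have "0 < group_exponent b t" using assms less_group_exponent_iff[of 0 b t] by simp
  then show ?thesis
    unfolding group_size_def using power_increasing[of 1 "group_exponent b t" "2::nat"] by simp
qed

text \<open>One doubling earlier the product is still below \<open>b\<close>, so the overshoot is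
  less than a factor of 2.\<close>

lemma group_size_mult_less:
  assumes "0 < t" "t < b"
  shows "group_size b t * t < 2 * b"
proof -
  obtain e where e: "group_exponent b t = Suc e"
    using assms less_group_exponent_iff[of 0 b t] by (cases "group_exponent b t") auto
  then have "2 ^ e * t < b" using less_group_exponent_iff[of e b t] by simp
  then show ?thesis by (simp add: group_size_def e)
qed

text \<open>Blocks below \<open>b\<close> at least double. This shows that \<open>depth\<close> is
  well defined and later bounds \<open>2 ^ i\<close> polynomially in \<open>b\<close>.\<close>

lemma power_2_le_block:
  assumes "\<And>j. j < i \<Longrightarrow> block b j < b"
  shows "2 ^ i \<le> block b i"
  using assms
proof (induction i)
  case (Suc i)
  have "2 ^ i * 2 \<le> block b i * groups b i"
    using Suc by (intro mult_mono group_size_ge_2) auto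
  then show ?case by simp
qed simp

lemma depth: "b \<le> block b (depth b)" and less_depthD: "i < depth b \<Longrightarrow> block b i < b"
proof -
  have "\<exists>i. b \<le> block b i"
  proof (rule ccontr)
    assume "\<nexists>i. b \<le> block b i"
    then have "2 ^ b \<le> block b b" "block b b < b" by (auto intro!: power_2_le_block simp: not_le)
    then show False using less_exp[of b] by linarith
  qed
  then show "b \<le> block b (depth b)" unfolding depth_def by (rule LeastI_ex)
  show "i < depth b \<Longrightarrow> block b i < b" unfolding depth_def using not_less_Least not_le by blast
qed

lemma block_mono: "i \<le> j \<Longrightarrow> block b i \<le> block b j"
  by (rule lift_Suc_mono_le[of "block b"]) (simp_all add: Suc_le_eq)

lemma less_depth_iff: "i < depth b \<longleftrightarrow> block b i < b"
  using less_depthD[of i b] depth[of b] block_mono[of "depth b" i b] by (cases "i < depth b") auto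

lemma block_less: "0 < b \<Longrightarrow> i \<le> depth b \<Longrightarrow> block b i < 2 * b"
  by (cases i) (auto simp: Suc_le_eq less_depth_iff mult.commute[of
      "block b _"] intro!: group_size_mult_less)

lemma power_2_le_block_depth: "i \<le> depth b \<Longrightarrow> 2 ^ i \<le> block b i"
  by (rule power_2_le_block) (simp add: less_depth_iff[symmetric])

lemma depth_le: "i \<le> depth b \<Longrightarrow> 0 < b \<Longrightarrow> i < 2 * b"
  using power_2_le_block_depth[of i b] block_less[of b i] less_exp[of i] by linarith

text \<open>The next block is at least 2 to the power of the present one, so passing to the
  logarithm of \<open>x\<close> goes down one level; \<open>x\<close> is general to allow this in
  the induction.\<close>

lemma less_log_star:
  assumes "real (block b i) < x" "i < depth b"
  shows "i < log_star x"
  using assms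
proof (induction i arbitrary: x)
  case 0
  then show ?case by (subst log_star.simps) simp
next
  case (Suc i)
  \<comment> \<open>The next block is still below \<open>b\<close>, so the cut-off did not act and
    the group has its full size \<open>2 ^ block b i\<close>.\<close>
  have nb: "\<not> b \<le> groups b i * block b i"
    using Suc.prems(2) by (auto simp: less_depth_iff mult.commute)
  then have "groups b i = 2 ^ block b i"
    using group_exponent_cases[of b "block b i"] by (auto simp: group_size_def)
  then have "2 ^ block b i \<le> block b (Suc i)" by (simp add: Suc_le_eq)
  then have "2 ^ block b i \<le> real (block b (Suc i))"
    by (metis of_nat_le_iff of_nat_numeral of_nat_power)
  also have x: "\<dots> < x" by (rule Suc.prems)
  finally have "real (block b i) < log 2 x" by (rule less_log_of_power) simp
  then have "i < log_star (log 2 x)" using Suc.prems(2) by (intro Suc.IH) auto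
  moreover have "1 < x" using x block_pos[of b "Suc i"] by linarith
  ultimately show ?case by (subst log_star.simps) simp
qed

lemma depth_le_log_star: "depth b \<le> log_star (real b)"
proof (cases "depth b")
  case (Suc i)
  then have "i < log_star (real b)" by (intro less_log_star[of b]) (simp_all flip: less_depth_iff)
  with Suc show ?thesis by simp
qed simp

lemma log_star_ge_2: "2 < x \<Longrightarrow> 2 \<le> log_star x"
proof -
  assume "2 < x"
  then have "1 < log 2 x" by simp
  then have "log_star (log 2 x) \<ge> 1" by (subst log_star.simps) simp
  then show ?thesis using \<open>2 < x\<close> by (subst log_star.simps) simp
qed

text \<open>The origin of the threshold 16: \<open>k + 1\<close> is at most \<open>2 ^ t\<close>,
  and 4 * (2 ^ t)^2 \<le> 16 ^ t for positive \<open>t\<close>.\<close>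

lemma nth_prime_le_power:
  assumes "16 \<le> l" "0 < t" "k < group_size b t"
  shows "nth_prime k \<le> l ^ t"
proof -
  have "group_size b t \<le> 2 ^ t"
    unfolding group_size_def by (intro power_increasing group_exponent_le) simp
  then have k: "k + 1 \<le> 2 ^ t" using assms(3) by linarith
  have "nth_prime k \<le> 4 * (k + 1)\<^sup>2" by (rule nth_prime_le)
  also have "\<dots> \<le> 4 * (2 ^ t)\<^sup>2" using k by (intro mult_left_mono power_mono) auto
  also have "\<dots> \<le> 4 ^ t * (2 ^ t)\<^sup>2"
    using assms(2) self_le_power[of "4::nat" t] by (intro mult_right_mono) auto
  also have "\<dots> = 16 ^ t" by (simp add: power2_eq_square flip: power_mult_distrib)
  also have "\<dots> \<le> l ^ t" using assms(1) by (rule power_mono) simp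
  finally show ?thesis .
qed

lemma code_bound_pos: "0 < code_bound b l i"
  by (cases i) (auto simp: code_bound_Suc modulus_pos)

lemma dot_bound_pos: "0 < l \<Longrightarrow> 0 < dot_bound b l i"
  by (simp add: dot_bound_def code_bound_pos)

text \<open>The factor \<open>l ^ (2 * block b i)\<close> absorbs the coordinates and the primes, leaving a pure squaring
  at each level.\<close>

lemma code_bound_le:
  assumes "16 \<le> l"
  shows "code_bound b l i * l ^ (2 * block b i) \<le> l ^ (3 * 2 ^ i * block b i)"
proof (induction i)
  case 0
  \<comment> \<open>The exponent 3 arises here: one factor \<open>l\<close> for the bound 2 on bits
    and two for the absorbing power.\<close>
  have "2 * l ^ 2 \<le> l * l ^ 2" using assms by (intro mult_right_mono) auto
  then show ?case by (simp add: power2_eq_square power3_eq_cube)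
next
  case (Suc i)
  define t where "t = block b i"
  define g where "g = groups b i"
  define M where "M = code_bound b l i"
  have l: "0 < l" "1 \<le> l" using assms by auto
  have t: "0 < t" by (simp add: t_def)
  have q: "modulus (dot_bound b l i) k \<le> (M * l ^ t)\<^sup>2" if "k < g" for k
  proof -
    have "modulus (dot_bound b l i) k \<le> dot_bound b l i * nth_prime k"
      using l(1) by (intro modulus_le dot_bound_pos)
    also have "\<dots> \<le> l * M\<^sup>2 * l ^ t"
      unfolding dot_bound_def M_def using assms that t
      by (intro mult_mono nth_prime_le_power[of _ _ _ b]) (auto simp: g_def t_def)
    \<comment> \<open>Enlarging the factor \<open>l\<close>, which counts the coordinates, to
      \<open>l ^ t\<close> completes a square.\<close>
    also have "\<dots> \<le> l ^ t * M\<^sup>2 * l ^ t"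
      using l t self_le_power[of l t] by (intro mult_right_mono) auto
    also have "\<dots> = (M * l ^ t)\<^sup>2" by (simp add: power2_eq_square)
    finally show ?thesis .
  qed
  have "code_bound b l (Suc i) \<le> (\<Prod>k<g. (M * l ^ t)\<^sup>2)"
    unfolding code_bound_Suc g_def[symmetric] using q by (intro prod_mono) auto
  also have "\<dots> = ((M * l ^ t)\<^sup>2) ^ g" by simp
  finally have "code_bound b l (Suc i) * l ^ (2 * block b (Suc i)) \<le>
      ((M * l ^ t)\<^sup>2) ^ g * (l ^ (2 * t)) ^ g"
    by (simp add: g_def t_def mult.assoc flip: power_mult)
  also have "\<dots> = ((M * l ^ (2 * t))\<^sup>2) ^ g"
    unfolding mult_2 power_add by (simp only: power2_eq_square mult_ac flip: power_mult_distrib)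
  also have "\<dots> \<le> ((l ^ (3 * 2 ^ i * t))\<^sup>2) ^ g"
    using Suc.IH by (intro power_mono) (auto simp: M_def t_def)
  also have "\<dots> = l ^ (3 * 2 ^ Suc i * block b (Suc i))"
    by (simp add: g_def t_def algebra_simps flip: power_mult)
  finally show ?case .
qed

lemma code_bound_le_power:
  assumes "16 \<le> l"
  shows "code_bound b l i \<le> l ^ (3 * 2 ^ i * block b i)"
proof -
  have "code_bound b l i * 1 \<le> code_bound b l i * l ^ (2 * block b i)"
    using assms by (intro mult_left_mono) (auto simp: Suc_le_eq)
  with code_bound_le[OF assms, of b i] show ?thesis by linarith
qed

text \<open>With L = \<open>log_star b\<close> the exponent is at most 3 * 2 ^ L * 2 b = 6 * 2 ^ L *
  b, and 6 \<le> 3 ^ L since L \<ge> 2.\<close>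

lemma code_bound_le_log_star:
  assumes "16 \<le> l" "2 < b" "i \<le> depth b"
  shows "code_bound b l i \<le> l ^ (6 ^ log_star (real b) * b)"
proof -
  define L where "L = log_star (real b)"
  have L: "2 \<le> L" unfolding L_def using assms(2) by (intro log_star_ge_2) simp
  have "i \<le> L" unfolding L_def using assms(3) depth_le_log_star[of b] by linarith
  then have "(2::nat) ^ i \<le> 2 ^ L" by (intro power_increasing) auto
  moreover have "block b i \<le> 2 * b" using block_less[of b i] assms by simp
  ultimately have "3 * 2 ^ i * block b i \<le> 3 * 2 ^ L * (2 * b)" by (intro mult_mono) auto
  also have "\<dots> = 2 ^ L * 6 * b" by simp
  also have "\<dots> \<le> 2 ^ L * 3 ^ L * b"
    using power_increasing[OF L, of "3::nat"] by (intro mult_right_mono mult_left_mono) auto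
  also have "\<dots> = 6 ^ L * b" by (simp flip: power_mult_distrib)
  finally have "l ^ (3 * 2 ^ i * block b i) \<le> l ^ (6 ^ L * b)"
    using assms(1) by (intro power_increasing) auto
  then show ?thesis using code_bound_le_power[OF assms(1), of b i] by (simp add: L_def)
qed

text \<open>Here \<open>2 ^ i\<close> is bounded by the block size, itself below
  \<open>2 * b\<close>. The polynomial exponent keeps the bit length of all codes polynomial in
  \<open>b\<close> and \<open>l\<close>.\<close>

lemma code_bound_le_poly:
  assumes "16 \<le> l" "0 < b" "i \<le> depth b"
  shows "code_bound b l i \<le> l ^ (12 * b\<^sup>2)"
proof -
  have "block b i \<le> 2 * b" using block_less[of b i] assms by simp
  moreover have "2 ^ i \<le> 2 * b" using power_2_le_block_depth[OF assms(3)] calculation by simp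
  ultimately have "3 * 2 ^ i * block b i \<le> 3 * (2 * b) * (2 * b)" by (intro mult_mono) auto
  then have "l ^ (3 * 2 ^ i * block b i) \<le> l ^ (12 * b\<^sup>2)"
    using assms(1) by (intro power_increasing) (auto simp: power2_eq_square)
  then show ?thesis using code_bound_le_power[OF assms(1), of b i] by simp
qed

section \<open>Correctness of the encoding\<close>

lemma code_less:
  assumes "\<And>j. a j < 2"
  shows "code b l i a j < code_bound b l i"
  using assms by (cases i) (auto simp: code_bound_Suc modulus_pos coprime_modulus intro!: crt_less)

lemma code_cong:
  "k < groups b i \<Longrightarrow>
    [code b l (Suc i) a j = code b l i a (j * groups b i + k)] (mod modulus (dot_bound b l i) k)"
  by (auto simp: modulus_pos coprime_modulus intro!: crt_cong)

text \<open>Padding survives every level, because a group of zeros is coded by 0.\<close>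

lemma code_eq_0:
  assumes "\<And>j. b \<le> j \<Longrightarrow> a j = 0" and "b \<le> j * block b i"
  shows "code b l i a j = 0"
  using assms(2)
proof (induction i arbitrary: j)
  case (Suc i)
  have "code b l i a (j * groups b i + k) = 0" for k
    by (rule Suc.IH) (use Suc.prems in \<open>simp add: algebra_simps\<close>)
  then show ?case by (simp add: crt_zero)
qed (use assms(1) in simp)

lemma zero_code_0: "0 < l \<Longrightarrow> zero_code b l i 0"
  by (induction i) (auto simp: dot_bound_pos)

lemma zero_code_less: "0 < l \<Longrightarrow> zero_code b l i v \<Longrightarrow> v < dot_bound b l i"
  by (cases i) (auto simp: dot_bound_pos)

text \<open>Reduction modulo the k-th prime power commutes with sums and products, so it turns an
  inner product of level \<open>i + 1\<close> into one of level \<open>i\<close>. All block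
  positions \<open>j\<close> are considered together, so that (j, k) -> j * g + k just reindexes
  them.\<close>

lemma zero_code_dot:
  fixes x y :: "nat \<Rightarrow> nat \<Rightarrow> nat" and b l :: nat
  assumes x: "\<And>c j. x c j < 2" and y: "\<And>c j. y c j < 2" and l: "0 < l"
  defines "S \<equiv> \<lambda>i j. \<Sum>c<l. code b l i (x c) j * code b l i (y c) j"
  shows "(\<forall>j. zero_code b l i (S i j)) \<longleftrightarrow> (\<forall>j. S 0 j = 0)"
proof (induction i)
  case (Suc i)
  have less: "S i j < dot_bound b l i" for i j
  proof -
    have "S i j < (\<Sum>c<l. (code_bound b l i)\<^sup>2)"
      unfolding S_def power2_eq_square using l x y
      by (intro sum_strict_mono mult_strict_mono code_less) (auto simp: code_bound_pos lessThan_empty_iff)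
    then show ?thesis by (simp add: dot_bound_def)
  qed
  let ?q = "modulus (dot_bound b l i)"
  \<comment> \<open>The remainder is the old inner product itself and not merely congruent to it, as
    that product lies below \<open>dot_bound\<close>, hence below the modulus.\<close>
  have red: "S (Suc i) j mod ?q k = S i (j * groups b i + k)" if "k < groups b i" for j k
  proof -
    have "[S (Suc i) j = S i (j * groups b i + k)] (mod ?q k)"
      unfolding S_def by (intro cong_sum cong_mult code_cong that)
    moreover have "S i (j * groups b i + k) < ?q k"
      using less le_modulus by (rule less_le_trans)
    ultimately show ?thesis by (simp add: cong_def)
  qed
  have "(\<forall>j. zero_code b l (Suc i) (S (Suc i) j)) \<longleftrightarrow>
      (\<forall>j. \<forall>k<groups b i. zero_code b l i (S i (j * groups b i + k)))"
    using less red by simp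
  also have "\<dots> \<longleftrightarrow> (\<forall>j. zero_code b l i (S i j))"
  proof safe
    fix n
    assume "\<forall>j. \<forall>k<groups b i. zero_code b l i (S i (j * groups b i + k))"
    from this[rule_format, of "n mod groups b i" "n div groups b i"]
    show "zero_code b l i (S i n)" by (simp only: div_mult_mod_eq) simp
  qed simp
  finally show ?case using Suc.IH by simp
qed simp

text \<open>The input is cut into \<open>l\<close> rows of \<open>b\<close> bits, one per coordinate
  of the code, so an inner product of level 0 runs down one of \<open>b\<close> columns. The zero
  beyond column \<open>b\<close> is the padding for \<open>code\<close>.\<close>

definition row :: "nat \<Rightarrow> int list \<Rightarrow> nat \<Rightarrow> nat \<Rightarrow> nat" where
  "row b x c j = (if j < b then nat (x ! (c * b + j)) else 0)"

definition psi :: "nat \<Rightarrow> nat \<Rightarrow> int list \<Rightarrow> int list" where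
  "psi b l x = map (\<lambda>c. int (code b l (depth b) (row b x c) 0)) [0..<l]"

definition zero_dots :: "nat \<Rightarrow> nat \<Rightarrow> int set" where
  "zero_dots b l = int ` {v. zero_code b l (depth b) v}"

lemma row_index_less: "c < l \<Longrightarrow> j < b \<Longrightarrow> c * b + j < b * (l::nat)"
proof -
  assume "c < l" "j < b"
  then have "c * b + j < Suc c * b" by simp
  also have "\<dots> \<le> l * b" using \<open>c < l\<close> by (intro mult_right_mono) auto
  finally show ?thesis by (simp add: mult.commute)
qed

lemma vecs_nth:
  "x \<in> vecs {0, 1} n \<Longrightarrow> i < n \<Longrightarrow> x ! i = 0 \<or> x ! i = 1"
  by (auto simp: vecs_def dest: nth_mem)

text \<open>All products of bits are nonnegative, so \<open>dot x y\<close> vanishes iff every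
  column sum does, which \<open>zero_code_dot\<close> transfers to the top level.\<close>

lemma psi_dot:
  assumes x: "x \<in> vecs {0, 1} (b * l)" and y: "y \<in> vecs {0, 1} (b * l)" and "0 < b" "0 < l"
  shows "dot x y = 0 \<longleftrightarrow> dot (psi b l x) (psi b l y) \<in> zero_dots b l"
proof -
  \<comment> \<open>For \<open>c \<ge> l\<close>, \<open>row\<close> may read beyond the end of the
    list, where nothing is known; zero rows make every entry less than 2, as
    \<open>zero_code_dot\<close> demands.\<close>
  define x' y' where "x' c = (if c < l then row b x c else (\<lambda>_. 0))"
    and "y' c = (if c < l then row b y c else (\<lambda>_. 0))" for c
  define S where "S i j = (\<Sum>c<l. code b l i (x' c) j * code b l i (y' c) j)" for i j
  have x': "x' c j < 2" and y': "y' c j < 2" for c j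
    using vecs_nth[OF x row_index_less[of c l j b]] vecs_nth[OF y row_index_less[of c l j b]]
    by (auto simp: x'_def y'_def row_def)
  \<comment> \<open>At the top a single block covers all \<open>b\<close> bits; the other blocks
    consist of padding.\<close>
  have 0: "S (depth b) j = 0" if "j \<noteq> 0" for j
  proof -
    have "b * 1 \<le> block b (depth b) * j" using that depth[of b] by (intro mult_mono) auto
    then have "b \<le> j * block b (depth b)" by (simp add: mult.commute)
    then have "code b l (depth b) (x' c) j = 0" for c
      by (intro code_eq_0) (auto simp: x'_def row_def)
    then show ?thesis by (simp add: S_def)
  qed
  have "dot (psi b l x) (psi b l y) = int (S (depth b) 0)"
    by (simp add: dot_def psi_def S_def x'_def y'_def)
  then have "dot (psi b l x) (psi b l y) \<in> zero_dots b l \<longleftrightarrow> zero_code b l (depth b) (S (depth b) 0)"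
    by (auto simp: zero_dots_def)
  also have "\<dots> \<longleftrightarrow> (\<forall>j. zero_code b l (depth b) (S (depth b) j))"
    using 0 zero_code_0[OF \<open>0 < l\<close>] by metis
  also have "\<dots> \<longleftrightarrow> (\<forall>j. S 0 j = 0)"
    unfolding S_def by (rule zero_code_dot) (use x' y' assms in auto)
  also have "\<dots> \<longleftrightarrow> (\<forall>c<l. \<forall>j<b. x ! (c * b + j) * y ! (c * b + j) = 0)"
  proof -
    have "x ! (c * b + j) * y ! (c * b + j) = int (x' c j * y' c j)" if "c < l" "j < b" for c j
      using vecs_nth[OF x row_index_less[OF that]] vecs_nth[OF y row_index_less[OF that]] that
      by (auto simp: x'_def y'_def row_def)
    then have "(\<forall>c<l. \<forall>j<b. x ! (c * b + j) * y ! (c * b + j) = 0) \<longleftrightarrow> (\<forall>c<l. \<forall>j<b. x' c j * y' c j = 0)"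
      by (metis of_nat_eq_0_iff)
    moreover have "x' c j * y' c j = 0" if "\<not> j < b" for c j
      using that by (simp add: x'_def row_def)
    moreover have "S 0 j = 0 \<longleftrightarrow> (\<forall>c<l. x' c j * y' c j = 0)" for j
      by (auto simp: S_def)
    ultimately show ?thesis by (metis (no_types, lifting))
  qed
  also have "\<dots> \<longleftrightarrow> (\<forall>i<b * l. x ! i * y ! i = 0)"
  proof safe
    fix i assume h: "\<forall>c<l. \<forall>j<b. x ! (c * b + j) * y ! (c * b + j) = 0" and "i < b * l"
    then have "i div b < l" by (simp add: less_mult_imp_div_less mult.commute)
    with h[rule_format, of "i div b" "i mod b"] \<open>0 < b\<close> show "x ! i * y ! i = 0" by simp
  qed (use row_index_less in blast)
  also have "\<dots> \<longleftrightarrow> dot x y = 0"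
  proof -
    have "length x = b * l" using x by (simp add: vecs_def)
    moreover have "0 \<le> x ! i * y ! i" if "i < b * l" for i
      using vecs_nth[OF x that] vecs_nth[OF y that] by auto
    ultimately show ?thesis unfolding dot_def by (subst sum_nonneg_eq_0_iff) auto
  qed
  finally show ?thesis by simp
qed

lemma psi_nth_less:
  assumes "x \<in> vecs {0, 1} (b * l)" "2 < b" "16 \<le> l" "i < l"
  shows "psi b l x ! i < int l ^ (6 ^ log_star (real b) * b)"
proof -
  have "row b x i j < 2" for j
    using vecs_nth[OF assms(1) row_index_less[OF assms(4), of j b]] by (auto simp: row_def)
  then have "code b l (depth b) (row b x i) 0 < code_bound b l (depth b)" by (rule code_less)
  also have "\<dots> \<le> l ^ (6 ^ log_star (real b) * b)"
    using assms by (intro code_bound_le_log_star) auto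
  finally have "int (code b l (depth b) (row b x i) 0) < int (l ^ (6 ^ log_star (real b) * b))"
    by (simp only: of_nat_less_iff)
  then show ?thesis using assms(4) by (simp add: psi_def)
qed

section \<open>Running times of programs on bounded states\<close>

text \<open>All cells of all arrays are included, so the cost of evaluating an expression is bounded
  in terms of \<open>r\<close> and its size alone, whatever addresses it uses.\<close>

definition bounded :: "nat \<Rightarrow> state \<Rightarrow> bool" where
  "bounded r s \<longleftrightarrow> (\<forall>x i. \<bar>s x i\<bar> \<le> 2 ^ r)"

text \<open>Numerals count with their absolute value instead of their length. This is harmless for
  the small constants in the programs and gives the plain bound \<open>2 ^ (r * asize e)\<close> on
  values.\<close>

fun asize :: "aexp \<Rightarrow> nat" where
  "asize (Num n) = nat \<bar>n\<bar> + 1"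
| "asize (Cell x e) = asize e + 1"
| "asize (Add e f) = asize e + asize f"
| "asize (Sub e f) = asize e + asize f"
| "asize (Mul e f) = asize e + asize f"
| "asize (Quot e f) = asize e + asize f"
| "asize (Rem e f) = asize e + asize f"

fun bsize :: "bexp \<Rightarrow> nat" where
  "bsize (Less e f) = asize e + asize f"
| "bsize (Equal e f) = asize e + asize f"
| "bsize (Neg p) = bsize p + 1"
| "bsize (Conj p q) = bsize p + bsize q + 1"

fun modified :: "com \<Rightarrow> vname set" where
  "modified Skip = {}"
| "modified (Assign x e f) = {x}"
| "modified (Seq c d) = modified c \<union> modified d"
| "modified (If p c d) = modified c \<union> modified d"
| "modified (While p c) = modified c"

lemma exec_not_modified: "exec c s t s' \<Longrightarrow> x \<notin> modified c \<Longrightarrow> s' x = s x"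
  by (induction rule: exec.induct) auto

lemma asize_pos: "1 \<le> asize e"
  by (induction e) auto

lemma abs_div_le_abs: "\<bar>a div b\<bar> \<le> \<bar>a\<bar>" for a b :: int
proof -
  have pos: "\<bar>a div b\<bar> \<le> \<bar>a\<bar>" if "0 < b" for a b :: int
  proof (cases "a < 0")
    case True
    then show ?thesis
      using that zdiv_mono2_neg[of a 1 b] div_neg_pos_less0[of a b] by simp
  next
    case False
    then show ?thesis
      using that zdiv_mono2[of a 1 b] pos_imp_zdiv_nonneg_iff[of b a] by simp
  qed
  show ?thesis
    using pos[of b a] pos[of "- b" "- a"] by (cases "b = 0"; cases "0 < b") auto
qed

lemma aval_bound:
  assumes "bounded r s" "1 \<le> r"
  shows "\<bar>aval e s\<bar> \<le> 2 ^ (r * asize e)"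
proof -
  \<comment> \<open>For numbers from 2 on, a sum is at most the product, so addition obeys the same
    bound as multiplication.\<close>
  have add: "a + b \<le> 2 ^ (r * (m + n))"
    if "a \<le> 2 ^ (r * m)" "b \<le> 2 ^ (r * n)" "1 \<le> m" "1 \<le> n" for a b :: int and m n
  proof -
    have ge2: "(2::int) \<le> 2 ^ (r * k)" if "1 \<le> k" for k
      using that assms(2) power_increasing[of 1 "r * k" "2::int"] by simp
    have "x + y \<le> x * y" if "2 \<le> x" "2 \<le> y" for x y :: int
      using mult_mono[of 1 "x - 1" 1 "y - 1"] that by (simp add: algebra_simps)
    from this[of "2 ^ (r * m)" "2 ^ (r * n)"] show ?thesis
      using that ge2[of m] ge2[of n] by (simp add: power_add distrib_left)
  qed
  have mono: "(2::int) ^ (r * m) \<le> 2 ^ (r * (m + n))" for m n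
    by (intro power_increasing) auto
  show ?thesis
  proof (induction e)
    case (Num n)
    have "\<bar>n\<bar> = int (nat \<bar>n\<bar>)" by simp
    also have "\<dots> \<le> int (2 ^ nat \<bar>n\<bar>)" by (intro of_nat_mono less_imp_le less_exp)
    also have "\<dots> = 2 ^ nat \<bar>n\<bar>" by simp
    also have "\<dots> \<le> 2 ^ (r * (nat \<bar>n\<bar> + 1))"
      using assms(2) mult_le_mono[of 1 r "nat \<bar>n\<bar>" "nat \<bar>n\<bar> + 1"] by (intro power_increasing) auto
    finally show ?case by simp
  next
    case (Cell x e)
    have "\<bar>s x (aval e s)\<bar> \<le> 2 ^ r" using assms(1) by (simp add: bounded_def)
    also have "\<dots> \<le> 2 ^ (r * asize (Cell x e))" by (intro power_increasing) auto
    finally show ?case by simp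
  next
    case (Add e f)
    from add[OF this asize_pos asize_pos] show ?case
      using abs_triangle_ineq[of "aval e s" "aval f s"] by simp
  next
    case (Sub e f)
    from add[OF this asize_pos asize_pos] show ?case
      using abs_triangle_ineq4[of "aval e s" "aval f s"] by simp
  next
    case (Mul e f)
    then show ?case by (simp add: abs_mult distrib_left power_add mult_mono)
  next
    case (Quot e f)
    have "\<bar>aval e s div aval f s\<bar> \<le> \<bar>aval e s\<bar>"
      by (rule abs_div_le_abs)
    also note Quot(1)
    also note mono[of "asize e" "asize f"]
    finally show ?case by simp
  next
    case (Rem e f)
    have "\<bar>aval e s mod aval f s\<bar> \<le> \<bar>aval e s\<bar> + \<bar>aval f s\<bar>"
      using abs_mod_less[of "aval f s" "aval e s"] by (cases "aval f s = 0") auto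
    with add[OF Rem asize_pos asize_pos] show ?case by simp
  qed
qed

lemma bit_size_le:
  assumes "\<bar>n\<bar> \<le> 2 ^ m"
  shows "bit_size n \<le> m + 2"
proof -
  have "nat \<bar>n\<bar> \<le> 2 ^ m" using assms by (simp add: nat_le_iff)
  also have "\<dots> < (2::nat) ^ (m + 1)" by simp
  finally have "floorlog 2 (nat \<bar>n\<bar>) \<le> m + 1" by (intro floorlog_leI) auto
  then show ?thesis by (simp add: bit_size_def)
qed

lemma bit_size_aval_le:
  assumes "bounded r s" "1 \<le> r"
  shows "bit_size (aval e s) \<le> 3 * (r * asize e)"
proof -
  have "1 * 1 \<le> r * asize e" using assms(2) asize_pos by (rule mult_le_mono)
  with bit_size_le[OF aval_bound[OF assms, of e]] show ?thesis by linarith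
qed

text \<open>The square of a sum exceeds the sum of the squares by a cross term, which pays for the
  operation at the root. This is why costs are bounded by squares.\<close>

lemma square_superadditive:
  assumes "c \<le> (3 * (r * m))\<^sup>2" "d \<le> (3 * (r * n))\<^sup>2" "u \<le> 3 * (r * m)" "v \<le> 3 * (r * n)"
    "1 \<le> r" "1 \<le> m" "1 \<le> (n::nat)"
  shows "c + d + u * v \<le> (3 * (r * (m + n)))\<^sup>2" and "c + d + u + v \<le> (3 * (r * (m + n)))\<^sup>2"
proof -
  have e: "(3 * (r * (m + n)))\<^sup>2 = (3 * (r * m))\<^sup>2 + (3 * (r * n))\<^sup>2 + 18 * ((r * m) * (r * n))"
    by (simp add: power2_eq_square algebra_simps)
  have "u * v \<le> (3 * (r * m)) * (3 * (r * n))" using assms by (intro mult_le_mono)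
  then show "c + d + u * v \<le> (3 * (r * (m + n)))\<^sup>2"
    using assms unfolding e by (simp add: algebra_simps)
  have "1 * 1 \<le> r * m" "1 * 1 \<le> r * n" using assms by (auto intro!: mult_le_mono)
  then have "(r * m) * 1 \<le> (r * m) * (r * n)" "1 * (r * n) \<le> (r * m) * (r * n)"
    by (auto intro!: mult_le_mono)
  then show "c + d + u + v \<le> (3 * (r * (m + n)))\<^sup>2"
    using assms unfolding e by linarith
qed

lemma acost_le:
  assumes "bounded r s" "1 \<le> r"
  shows "acost e s \<le> (3 * (r * asize e))\<^sup>2"
proof (induction e)
  case (Num n)
  have "1 * 1 \<le> 3 * (r * asize (Num n))" using assms(2) by (intro mult_le_mono) auto
  then have "3 * (r * asize (Num n)) \<le> (3 * (r * asize (Num n)))\<^sup>2"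
    by (intro self_le_power) auto
  with bit_size_aval_le[OF assms, of "Num n"] show ?case by simp
next
  case (Cell x e)
  have "bit_size (aval (Cell x e) s) \<le> r + 2"
    using assms(1) by (intro bit_size_le) (simp add: bounded_def)
  then have "bit_size (aval (Cell x e) s) \<le> 3 * (r * 1)" using assms(2) by simp
  from square_superadditive(2)[OF Cell _ bit_size_aval_le[OF assms] this, of 0] show ?case
    using assms(2) asize_pos by simp
qed (simp only: acost.simps asize.simps;
    intro square_superadditive bit_size_aval_le[OF assms] assms(2) asize_pos; assumption)+

lemma bsize_pos: "1 \<le> bsize p"
  by (induction p) (use asize_pos in \<open>auto simp: Suc_le_eq add_pos_pos\<close>)

lemma bcost_le:
  assumes "bounded r s" "1 \<le> r"
  shows "bcost p s \<le> (3 * (r * bsize p))\<^sup>2"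
proof (induction p)
  case (Neg p)
  from square_superadditive(2)[OF this, of 0 1 1 0] show ?case
    using assms(2) bsize_pos by simp
next
  case (Conj p q)
  have "1 * 1 \<le> r * bsize q" using assms(2) bsize_pos by (rule mult_le_mono)
  then have "bcost p s + bcost q s + 0 + 1 \<le> (3 * (r * (bsize p + bsize q)))\<^sup>2"
    using Conj assms(2) bsize_pos by (intro square_superadditive) auto
  also have "\<dots> \<le> (3 * (r * bsize (Conj p q)))\<^sup>2" by (intro power_mono mult_left_mono) auto
  finally show ?case by simp
qed (simp only: bcost.simps bsize.simps;
    intro square_superadditive bit_size_aval_le[OF assms] acost_le[OF assms] assms(2) asize_pos)+

text \<open>One unit of time pays for an assignment or a test whose expressions have size at most 20, in a
  state with numbers of at most \<open>r\<close> bits.\<close>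

definition runs :: "nat \<Rightarrow> com \<Rightarrow> state \<Rightarrow> nat \<Rightarrow> (state \<Rightarrow> bool) \<Rightarrow> bool" where
  "runs r c s n Q \<longleftrightarrow> (\<exists>t s'. exec c s t s' \<and> t \<le> n * (60 * r)\<^sup>2 \<and> bounded r s' \<and> Q s')"

section \<open>Hoare-style rules with time bounds\<close>

lemma unit_cost: "m \<le> 20 \<Longrightarrow> (3 * (r * m))\<^sup>2 \<le> (60 * r)\<^sup>2" for r m :: nat
  by (intro power_mono) auto

lemma runs_mono: "runs r c s m P \<Longrightarrow> m \<le> n \<Longrightarrow> (\<And>s'. P s' \<Longrightarrow> Q s') \<Longrightarrow> runs r c s n Q"
  unfolding runs_def by (meson le_trans mult_le_mono1)

lemma runs_Skip: "1 \<le> r \<Longrightarrow> bounded r s \<Longrightarrow> Q s \<Longrightarrow> runs r Skip s 1 Q"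
  unfolding runs_def by (intro exI[of _ 1] exI[of _ s]) (auto intro: exec.Skip[unfolded One_nat_def]
      simp: Suc_le_eq)

definition upd :: "state \<Rightarrow> vname \<Rightarrow> int \<Rightarrow> int \<Rightarrow> state" where
  "upd s x i v = s(x := (s x)(i := v))"

lemma upd_apply [simp]: "upd s x i v y = (if y = x then (s x)(i := v) else s y)"
  by (simp add: upd_def)

lemma runs_assign:
  assumes "1 \<le> r" "bounded r s" "asize e + asize f \<le> 20" "\<bar>aval f s\<bar> \<le> 2 ^ r"
    and "Q (upd s x (aval e s) (aval f s))"
  shows "runs r (Assign x e f) s 1 Q"
proof -
  have "acost e s + acost f s + bit_size (aval e s) + bit_size (aval f s) \<le>
      (3 * (r * (asize e + asize f)))\<^sup>2"
    using assms(1,2) by (intro square_superadditive acost_le bit_size_aval_le asize_pos)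
  also have "\<dots> \<le> 1 * (60 * r)\<^sup>2" using unit_cost[OF assms(3)] by simp
  finally have "acost e s + acost f s + bit_size (aval e s) + bit_size (aval f s) \<le> 1 * (60 * r)\<^sup>2" .
  moreover have "bounded r (upd s x (aval e s) (aval f s))"
    using assms(2,4) by (auto simp: bounded_def)
  ultimately show ?thesis
    unfolding runs_def using exec.Assign[of x e f s, folded upd_def] assms(5) by blast
qed

text \<open>The frame property is built in: the second program may assume that arrays outside
  \<open>modified c\<close> are unchanged, so postconditions need only mention what changes.\<close>

lemma runs_Seq:
  assumes "runs r c s m P"
    and "\<And>s'. bounded r s' \<Longrightarrow> (\<And>x. x \<notin> modified c \<Longrightarrow> s' x = s x) \<Longrightarrow> P s' \<Longrightarrow> runs r d s' n Q"
  shows "runs r (Seq c d) s (m + n) Q"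
proof -
  obtain t s1 where 1: "exec c s t s1" "t \<le> m * (60 * r)\<^sup>2" "bounded r s1" "P s1"
    using assms(1) by (auto simp: runs_def)
  then obtain u s2 where "exec d s1 u s2" "u \<le> n * (60 * r)\<^sup>2" "bounded r s2" "Q s2"
    using assms(2)[of s1] exec_not_modified[OF 1(1)] by (auto simp: runs_def)
  with 1 show ?thesis
    unfolding runs_def by (intro exI[of _ "t + u"] exI[of _ s2]) (auto intro: exec.Seq simp: distrib_right)
qed

lemma runs_assign_Seq:
  assumes "1 \<le> r" "bounded r s" "asize e + asize f \<le> 20" "\<bar>aval f s\<bar> \<le> 2 ^ r"
    and "bounded r (upd s x (aval e s) (aval f s)) \<Longrightarrow> runs r d (upd s x (aval e s) (aval f s)) n Q"
  shows "runs r (Seq (Assign x e f) d) s (1 + n) Q"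
proof (rule runs_Seq)
  show "runs r (Assign x e f) s 1 (\<lambda>s'. s' = upd s x (aval e s) (aval f s))"
    using assms by (intro runs_assign) auto
qed (use assms(5) in auto)

lemma runs_If:
  assumes "1 \<le> r" "bounded r s" "bsize p \<le> 20"
    and "bval p s \<Longrightarrow> runs r c s n Q" and "\<not> bval p s \<Longrightarrow> runs r d s n Q"
  shows "runs r (If p c d) s (n + 1) Q"
proof -
  have cost: "bcost p s \<le> (60 * r)\<^sup>2"
    using bcost_le[OF assms(2,1)] unit_cost[OF assms(3)] by (rule order_trans)
  show ?thesis
  proof (cases "bval p s")
    case True
    with assms(4) obtain t s' where "exec c s t s'" "t \<le> n * (60 * r)\<^sup>2" "bounded r s'" "Q s'"
      by (auto simp: runs_def)
    with True cost show ?thesis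
      unfolding runs_def by (intro exI[of _ "bcost p s + t"] exI[of _ s']) (auto intro: exec.IfTrue)
  next
    case False
    with assms(5) obtain t s' where "exec d s t s'" "t \<le> n * (60 * r)\<^sup>2" "bounded r s'" "Q s'"
      by (auto simp: runs_def)
    with False cost show ?thesis
      unfolding runs_def by (intro exI[of _ "bcost p s + t"] exI[of _ s']) (auto intro: exec.IfFalse)
  qed
qed

text \<open>The invariant carries the number \<open>k\<close> of completed iterations, and each
  iteration has to prove \<open>k < n\<close>; this yields termination. Every iteration pays one
  unit for the test, and the failing test pays the last.\<close>

lemma runs_While:
  assumes "1 \<le> r" "bounded r s" "bsize p \<le> 20" "I 0 s"
    and step: "\<And>k s'. bounded r s' \<Longrightarrow> (\<And>x. x \<notin> modified c \<Longrightarrow> s' x = s x) \<Longrightarrow> I k s' \<Longrightarrow> bval p s' \<Longrightarrow>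
      k < n \<and> runs r c s' m (I (Suc k))"
    and exit: "\<And>k s'. bounded r s' \<Longrightarrow> (\<And>x. x \<notin> modified c \<Longrightarrow> s' x = s x) \<Longrightarrow> I k s' \<Longrightarrow> \<not> bval p s' \<Longrightarrow> Q s'"
  shows "runs r (While p c) s (n * (m + 1) + 1) Q"
proof -
  have cost: "bcost p s' \<le> (60 * r)\<^sup>2" if "bounded r s'" for s'
    using bcost_le[OF that assms(1)] unit_cost[OF assms(3)] by (rule order_trans)
  have "runs r (While p c) s' ((n - k) * (m + 1) + 1) Q"
    if "bounded r s'" "\<And>x. x \<notin> modified c \<Longrightarrow> s' x = s x" "I k s'" for k s'
    using that
  proof (induction "n - k" arbitrary: k s' rule: less_induct)
    case less
    show ?case
    proof (cases "bval p s'")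
      case True
      have k: "k < n" and c: "runs r c s' m (I (Suc k))"
        using step[OF less.prems(1,2,3) True] by auto
      from c obtain t s1 where 1: "exec c s' t s1" "t \<le> m * (60 * r)\<^sup>2" "bounded r s1" "I (Suc k) s1"
        by (auto simp: runs_def)
      have "runs r (While p c) s1 ((n - Suc k) * (m + 1) + 1) Q"
        using k 1 less.prems(2) exec_not_modified[OF 1(1)] by (intro less.hyps) auto
      then obtain u s2 where 2: "exec (While p c) s1 u s2"
        "u \<le> ((n - Suc k) * (m + 1) + 1) * (60 * r)\<^sup>2" "bounded r s2" "Q s2"
        by (auto simp: runs_def)
      have "n - k = Suc (n - Suc k)" using k by simp
      then have "((n - k) * (m + 1) + 1) * (60 * r)\<^sup>2 =
          (60 * r)\<^sup>2 + m * (60 * r)\<^sup>2 + ((n - Suc k) * (m + 1) + 1) * (60 * r)\<^sup>2"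
        by (simp add: algebra_simps)
      then have "bcost p s' + t + u \<le> ((n - k) * (m + 1) + 1) * (60 * r)\<^sup>2"
        using cost[OF less.prems(1)] 1(2) 2(2) by linarith
      with 2 show ?thesis
        unfolding runs_def using exec.WhileTrue[OF True 1(1) 2(1)] by blast
    next
      case False
      have "bcost p s' \<le> ((n - k) * (m + 1) + 1) * (60 * r)\<^sup>2"
        using cost[OF less.prems(1)] by (simp add: add_mult_distrib)
      with False less.prems exit[OF less.prems False] show ?thesis
        unfolding runs_def using exec.WhileFalse[OF False, of c] by blast
    qed
  qed
  from this[of s 0] assms show ?thesis by simp
qed

section \<open>The incremental Chinese remainder algorithm\<close>

notation Seq (infixr ";;" 60)

abbreviation var :: "vname \<Rightarrow> aexp" where "var x \<equiv> Cell x (Num 0)"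

abbreviation assign :: "vname \<Rightarrow> aexp \<Rightarrow> com" (infix "::=" 61) where "x ::= e \<equiv> Assign x (Num 0) e"

text \<open>Trial division upwards from 2 stops at the least divisor above 1, which is
  \<open>p\<close> exactly if \<open>p\<close> is prime.\<close>

definition find_divisor :: com where
  "find_divisor = ''d'' ::= Num 2 ;;
    While (Neg (Equal (Rem (var ''p'') (var ''d'')) (Num 0))) (''d'' ::= Add (var ''d'') (Num 1))"

abbreviation residue :: aexp where
  "residue \<equiv> Cell ''a'' (Add (Mul (var ''j'') (var ''g'')) (var ''k''))"

text \<open>The modulus \<open>q\<close> grows by one prime factor \<open>p\<close> at a time: each time fewer than \<open>p\<close> multiples of
  the product \<open>Q\<close> of the previous moduli have to be tried, which is polynomial although \<open>q\<close> is not.\<close>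

definition match_residue :: com where
  "match_residue =
    While (Neg (Equal (Rem (Sub (var ''X'') residue) (var ''q'')) (Num 0)))
      (''X'' ::= Add (var ''X'') (var ''Q''))"

definition add_modulus :: com where
  "add_modulus = ''q'' ::= Num 1 ;;
    While (Less (var ''q'') (var ''K''))
      (''q'' ::= Mul (var ''q'') (var ''p'') ;; match_residue ;; ''Q'' ::= Mul (var ''Q'') (var ''p''))"

text \<open>The encoder uses the solution \<open>X\<close> of the congruences with residues in \<open>a\<close>; the enumeration of
  \<open>V\<close> uses the flag \<open>f\<close>, which tells whether \<open>Z\<close> is nonzero at all residues of \<open>v\<close>.\<close>

definition sweep :: com where
  "sweep = ''X'' ::= Num 0 ;; ''Q'' ::= Num 1 ;; ''f'' ::= Num 1 ;; ''k'' ::= Num 0 ;; ''p'' ::= Num 1 ;;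
    While (Less (var ''k'') (var ''g''))
      (''p'' ::= Add (var ''p'') (Num 1) ;;
       find_divisor ;;
       If (Equal (var ''d'') (var ''p''))
         (add_modulus ;;
          If (Equal (Cell ''Z'' (Rem (var ''v'') (var ''q''))) (Num 0)) (''f'' ::= Num 0) Skip ;;
          ''k'' ::= Add (var ''k'') (Num 1))
         Skip)"

section \<open>Verification of the sweep over the primes\<close>

lemma int_le_two_power: "n \<le> r \<Longrightarrow> int n \<le> 2 ^ r"
proof -
  assume "n \<le> r"
  then have "n \<le> 2 ^ r" using less_exp[of r] by linarith
  then show ?thesis by (metis of_nat_le_iff of_nat_numeral of_nat_power)
qed

lemma int_le_two_power': "n \<le> 2 ^ r \<Longrightarrow> int n \<le> 2 ^ r"
  by (metis of_nat_le_iff of_nat_numeral of_nat_power)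

lemma runs_find_divisor:
  assumes r: "1 \<le> r" "bounded r s" and p: "s ''p'' 0 = int p" "2 \<le> p" "p \<le> r"
  shows "runs r find_divisor s (4 * r) (\<lambda>s'. s' ''d'' 0 = int p \<longleftrightarrow> prime p)"
proof -
  let ?I = "\<lambda>k s'. s' ''d'' 0 = int (2 + k) \<and> 2 + k \<le> p \<and> (\<forall>m. 2 \<le> m \<and> m < 2 + k \<longrightarrow> \<not> m dvd p)"
  have two: "(2::int) \<le> 2 ^ r" using int_le_two_power[of 2 r] p by simp
  have "runs r find_divisor s (1 + (r * (1 + 1) + 1)) (\<lambda>s'. s' ''d'' 0 = int p \<longleftrightarrow> prime p)"
    unfolding find_divisor_def
  proof (rule runs_assign_Seq)
    let ?s = "upd s ''d'' (aval (Num 0) s) (aval (Num 2) s)"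
    assume b: "bounded r ?s"
    show "runs r (While (Neg (Equal (Rem (var ''p'') (var ''d'')) (Num 0)))
        (''d'' ::= Add (var ''d'') (Num 1))) ?s (r * (1 + 1) + 1) (\<lambda>s'. s' ''d'' 0 = int p \<longleftrightarrow> prime p)"
    proof (rule runs_While[where I = ?I])
      fix k s'
      assume s': "bounded r s'" "\<And>x. x \<notin> modified (''d'' ::= Add (var ''d'') (Num 1)) \<Longrightarrow> s' x = ?s x"
          "?I k s'"
        "bval (Neg (Equal (Rem (var ''p'') (var ''d'')) (Num 0))) s'"
      have "s' ''p'' 0 = int p" using s'(2)[of "''p''"] p by simp
      with s'(3,4) have nd: "\<not> (2 + k) dvd p"
        by (simp add: dvd_eq_mod_eq_0 flip: of_nat_mod del: of_nat_add add_2_eq_Suc)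
      then have "2 + k < p" using s'(3) by (metis dvd_refl le_neq_implies_less)
      moreover have "\<forall>m. 2 \<le> m \<and> m < 3 + k \<longrightarrow> \<not> m dvd p"
        using s'(3) nd by (auto simp: less_Suc_eq numeral_eq_Suc)
      ultimately show "k < r \<and> runs r (''d'' ::= Add (var ''d'') (Num 1)) s' 1 (?I (Suc k))"
        by (intro conjI runs_assign) (use s' r p int_le_two_power[of "3 + k" r] in auto)
    next
      fix k s'
      assume s': "bounded r s'" "\<And>x. x \<notin> modified (''d'' ::= Add (var ''d'') (Num 1)) \<Longrightarrow> s' x = ?s x"
          "?I k s'"
        "\<not> bval (Neg (Equal (Rem (var ''p'') (var ''d'')) (Num 0))) s'"
      have "s' ''p'' 0 = int p" using s'(2)[of "''p''"] p by simp
      with s'(3,4) have d: "(2 + k) dvd p"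
        by (simp add: dvd_eq_mod_eq_0 flip: of_nat_mod del: of_nat_add add_2_eq_Suc)
      have "2 + k = p \<longleftrightarrow> prime p"
      proof
        assume e: "2 + k = p"
        show "prime p"
        proof (rule prime_nat_iff[THEN iffD2], intro conjI allI impI)
          fix m assume m: "m dvd p"
          then have "m \<le> p" "m \<noteq> 0" using p(2) by (auto dest: dvd_imp_le intro: ccontr)
          then show "m = 1 \<or> m = p" using m s'(3) e by (cases "m < 2") fastforce+
        qed (use p in simp)
      next
        assume "prime p"
        with d show "2 + k = p" by (auto simp: prime_nat_iff)
      qed
      with s'(3) show "s' ''d'' 0 = int p \<longleftrightarrow> prime p" by (simp only: of_nat_eq_iff)
    qed (use r b p in auto)
  qed (use r two in auto)
  then show ?thesis by (rule runs_mono) (use r in auto)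
qed

text \<open>Write c - X = q z. After division by \<open>q\<close> the condition is d Q = z modulo
  \<open>p\<close>, solvable because \<open>Q\<close> is invertible there.\<close>

lemma ex_match:
  fixes p Q q c X :: nat
  assumes "[X = c] (mod q)" "coprime Q p" "0 < p"
  shows "\<exists>d<p. [X + d * (Q * q) = c] (mod q * p)"
proof -
  from assms(1) have "int q dvd int c - int X"
    by (metis cong_iff_dvd_diff cong_int_iff cong_sym)
  then obtain z where z: "int c - int X = int q * z" ..
  from assms(2) have "coprime (int Q) (int p)" by simp
  then obtain y where y: "[int Q * y = 1] (mod int p)" using cong_solve_coprime_int by blast
  define d where "d = nat ((y * z) mod int p)"
  have d: "int d = (y * z) mod int p" using assms(3) by (simp add: d_def)
  have "[int d * int Q = y * z * int Q] (mod int p)"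
    unfolding d by (simp add: cong_def mod_mult_left_eq)
  also have "[y * z * int Q = 1 * z] (mod int p)"
    using cong_mult[OF y cong_refl[of z]] by (simp add: mult_ac)
  finally have "int p dvd int d * int Q - z" by (simp add: cong_iff_dvd_diff)
  then have "int q * int p dvd int q * (int d * int Q - z)" by (rule mult_dvd_mono[OF dvd_refl])
  also have "int q * (int d * int Q - z) = int (X + d * (Q * q)) - int c"
    using z by (simp add: algebra_simps)
  finally have "[int (X + d * (Q * q)) = int c] (mod int (q * p))" by (simp add: cong_iff_dvd_diff)
  then have "[X + d * (Q * q) = c] (mod q * p)" by (simp only: cong_int_iff)
  moreover have "d < p" using d assms(3) by (metis of_nat_less_iff pos_mod_bound of_nat_0_less_iff)
  ultimately show ?thesis by blast
qed

text \<open>\<open>Q\<close> is the product of the earlier moduli and \<open>q\<close> the power of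
  \<open>p\<close> already treated: the cell \<open>''Q''\<close> still holds \<open>Q * q\<close>,
  whereas \<open>''q''\<close> already holds \<open>q * p\<close>. Adding \<open>Q * q\<close> keeps
  the congruences modulo \<open>Q\<close> and \<open>q\<close>.\<close>

lemma runs_match_residue:
  assumes r: "1 \<le> r" "bounded r s"
    and s: "s ''X'' 0 = int X0" "s ''Q'' 0 = int (Q * q)" "s ''q'' 0 = int (q * p)"
      "s ''a'' (s ''j'' 0 * s ''g'' 0 + s ''k'' 0) = int c"
    and "[X0 = c] (mod q)" "coprime Q p" "X0 < Q * q" "Q * q * p \<le> 2 ^ r" "0 < p" "p \<le> r"
  shows "runs r match_residue s (2 * r + 1)
    (\<lambda>s'. \<exists>X. s' ''X'' 0 = int X \<and> X < Q * q * p \<and> [X = X0] (mod Q) \<and> [X = c] (mod q * p))"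
proof -
  obtain d where d: "d < p" "[X0 + d * (Q * q) = c] (mod q * p)"
    using ex_match[of X0 c q Q p] assms by blast
  \<comment> \<open>At most \<open>p - 1\<close> additions occur, so the candidate stays below the
    next product and within \<open>r\<close> bits.\<close>
  have less: "X0 + k * (Q * q) < Q * q * p" if "k \<le> d" for k
  proof -
    have "X0 + k * (Q * q) < Suc k * (Q * q)" using assms by simp
    also have "\<dots> \<le> p * (Q * q)" using that d by (intro mult_right_mono) auto
    finally show ?thesis by (simp add: mult_ac)
  qed
  have eq: "bval (Equal (Rem (Sub (var ''X'') residue) (var ''q'')) (Num 0)) s' \<longleftrightarrow> [X = c] (mod q * p)"
    if "\<And>x. x \<notin> {''X''} \<Longrightarrow> s' x = s x" "s' ''X'' 0 = int X" for s' X
  proof -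
    have "bval (Equal (Rem (Sub (var ''X'') residue) (var ''q'')) (Num 0)) s' \<longleftrightarrow>
        (int X - int c) mod int (q * p) = 0"
      using that s by simp
    also have "\<dots> \<longleftrightarrow> [int X = int c] (mod int (q * p))"
      by (simp only: cong_iff_dvd_diff dvd_eq_mod_eq_0)
    finally show ?thesis by (simp only: cong_int_iff)
  qed
  let ?I = "\<lambda>k s'. s' ''X'' 0 = int (X0 + k * (Q * q)) \<and> k \<le> d"
  have "runs r match_residue s (r * (1 + 1) + 1)
    (\<lambda>s'. \<exists>X. s' ''X'' 0 = int X \<and> X < Q * q * p \<and> [X = X0] (mod Q) \<and> [X = c] (mod q * p))"
    unfolding match_residue_def
  proof (rule runs_While[where I = ?I])
    fix k s'
    assume s': "bounded r s'" "\<And>x. x \<notin> modified (''X'' ::= Add (var ''X'') (var ''Q'')) \<Longrightarrow> s' x = s x"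
        "?I k s'"
      "bval (Neg (Equal (Rem (Sub (var ''X'') residue) (var ''q'')) (Num 0))) s'"
    have "\<not> [X0 + k * (Q * q) = c] (mod q * p)"
      using eq[of s' "X0 + k * (Q * q)"] s' by simp
    with d s'(3) have k: "k < d" by (metis le_neq_implies_less)
    have "X0 + Suc k * (Q * q) \<le> 2 ^ r" using less[of "Suc k"] k assms by simp
    then have "int (X0 + Suc k * (Q * q)) \<le> 2 ^ r" by (rule int_le_two_power')
    then show "k < r \<and> runs r (''X'' ::= Add (var ''X'') (var ''Q'')) s' 1 (?I (Suc k))"
      by (intro conjI runs_assign) (use s' s r k d assms in \<open>auto simp: algebra_simps\<close>)
  next
    fix k s'
    assume s': "bounded r s'" "\<And>x. x \<notin> modified (''X'' ::= Add (var ''X'') (var ''Q'')) \<Longrightarrow> s' x = s x"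
        "?I k s'"
      "\<not> bval (Neg (Equal (Rem (Sub (var ''X'') residue) (var ''q'')) (Num 0))) s'"
    have "[X0 + k * (Q * q) = c] (mod q * p)"
      using eq[of s' "X0 + k * (Q * q)"] s' by simp
    moreover have "[X0 + k * (Q * q) = X0] (mod Q)"
      by (simp add: cong_def mult.left_commute[of k Q q])
    ultimately show "\<exists>X. s' ''X'' 0 = int X \<and> X < Q * q * p \<and> [X = X0] (mod Q) \<and> [X = c] (mod q * p)"
      using s'(3) less by blast
  qed (use r s in auto)
  then show ?thesis by (rule runs_mono) auto
qed

text \<open>After \<open>e\<close> rounds \<open>X\<close> solves the old congruences and the new
  one modulo \<open>p ^ e\<close>. The loop leaves at the first power not below \<open>K\<close>,
  that is at the least exponent.\<close>

lemma runs_add_modulus: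
  assumes r: "1 \<le> r" "bounded r s"
    and s: "s ''X'' 0 = int X0" "s ''Q'' 0 = int Q" "s ''p'' 0 = int p" "s ''K'' 0 = int K"
      "s ''a'' (s ''j'' 0 * s ''g'' 0 + s ''k'' 0) = int c"
    and p: "2 \<le> p" "p \<le> r" "coprime Q p"
    and E: "E = least_exponent K p" "X0 < Q" "Q * p ^ E \<le> 2 ^ r"
  shows "runs r add_modulus s (8 * r\<^sup>2)
    (\<lambda>s'. s' ''q'' 0 = int (p ^ E) \<and> s' ''Q'' 0 = int (Q * p ^ E) \<and>
      (\<exists>X. s' ''X'' 0 = int X \<and> X < Q * p ^ E \<and> [X = X0] (mod Q) \<and> [X = c] (mod p ^ E)))"
proof -
  let ?R = "\<lambda>e s'. s' ''q'' 0 = int (p ^ e) \<and> s' ''Q'' 0 = int (Q * p ^ e) \<and>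
      (\<exists>X. s' ''X'' 0 = int X \<and> X < Q * p ^ e \<and> [X = X0] (mod Q) \<and> [X = c] (mod p ^ e))"
  let ?I = "\<lambda>e s'. e \<le> E \<and> ?R e s'"
  have Qpos: "0 < Q" using E by simp
  have le: "Q * p ^ e \<le> 2 ^ r" "p ^ e \<le> 2 ^ r" if "e \<le> E" for e
  proof -
    have "Q * p ^ e \<le> Q * p ^ E" using that p by (intro mult_left_mono power_increasing) auto
    then show 1: "Q * p ^ e \<le> 2 ^ r" using E(3) by (rule order_trans)
    have "1 * p ^ e \<le> Q * p ^ e" using Qpos by (intro mult_right_mono) auto
    with 1 show "p ^ e \<le> 2 ^ r" by linarith
  qed
  \<comment> \<open>The number of rounds is at most the bit length of the modulus, as
    \<open>p\<close> is at least 2.\<close>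
  have Er: "E \<le> r"
  proof -
    have "2 ^ E \<le> p ^ E" using p by (intro power_mono) auto
    also have "\<dots> \<le> 2 ^ r" using le by simp
    finally show ?thesis by simp
  qed
  let ?body = "''q'' ::= Mul (var ''q'') (var ''p'') ;; match_residue ;; ''Q'' ::= Mul (var ''Q'')
      (var ''p'')"
  have "runs r add_modulus s (1 + (r * ((1 + ((2 * r + 1) + 1)) + 1) + 1)) (?R E)"
    unfolding add_modulus_def
  proof (rule runs_assign_Seq)
    let ?s = "upd s ''q'' (aval (Num 0) s) (aval (Num 1) s)"
    assume b: "bounded r ?s"
    show "runs r (While (Less (var ''q'') (var ''K'')) ?body) ?s (r * ((1 + ((2 * r + 1) + 1)) + 1) + 1)
        (?R E)"
    proof (rule runs_While[where I = ?I])
      fix e s'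
      assume s': "bounded r s'" "\<And>x. x \<notin> modified ?body \<Longrightarrow> s' x = ?s x" "?I e s'"
        "bval (Less (var ''q'') (var ''K'')) s'"
      have eqs: "s' ''p'' = s ''p''" "s' ''K'' = s ''K''" "s' ''a'' = s ''a''" "s' ''j'' = s ''j''"
          "s' ''g'' = s ''g''"
        "s' ''k'' = s ''k''"
        using s'(2) by (simp_all add: match_residue_def)
      from s'(3) obtain X where X: "s' ''X'' 0 = int X" "X < Q * p ^ e" "[X = X0] (mod Q)"
          "[X = c] (mod p ^ e)"
        by blast
      have "int (p ^ e) < int K" using s'(3,4) s eqs by simp
      then have "p ^ e < K" by (simp only: of_nat_less_iff)
      then have "e \<noteq> E" using least_exponent(1)[OF p(1), of K] E(1) by auto
      with s'(3) have e: "e < E" by simp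
      have bd: "int (p ^ Suc e) \<le> 2 ^ r" "int (Q * p ^ Suc e) \<le> 2 ^ r"
        using le[of "Suc e"] e by (auto intro!: int_le_two_power' simp del: of_nat_mult of_nat_power)
      have "runs r ?body s' (1 + ((2 * r + 1) + 1)) (?I (Suc e))"
      proof (rule runs_assign_Seq)
        let ?t = "upd s' ''q'' (aval (Num 0) s') (aval (Mul (var ''q'') (var ''p'')) s')"
        assume bt: "bounded r ?t"
        show "runs r (match_residue ;; ''Q'' ::= Mul (var ''Q'') (var ''p'')) ?t ((2 * r + 1) + 1)
            (?I (Suc e))"
        proof (rule runs_Seq)
          show "runs r match_residue ?t (2 * r + 1) (\<lambda>s'. \<exists>X'. s' ''X'' 0 = int X' \<and>
              X' < Q * p ^ e * p \<and> [X' = X] (mod Q) \<and> [X' = c] (mod p ^ e * p))"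
            by (rule runs_match_residue) (use r bt X eqs s s'(3) p le[of
                "Suc e"] e in \<open>simp_all add: mult_ac\<close>)
        next
          fix u
          assume u: "bounded r u" "\<And>x. x \<notin> modified match_residue \<Longrightarrow> u x = ?t x"
            "\<exists>X'. u ''X'' 0 = int X' \<and> X' < Q * p ^ e * p \<and> [X' = X] (mod Q) \<and> [X' = c] (mod p ^ e * p)"
          have ueq: "u ''Q'' = s' ''Q''" "u ''p'' = s' ''p''" "u ''q'' 0 = int (p ^ Suc e)"
            using u(2) s'(3) eqs s by (simp_all add: match_residue_def)
          from u(3) obtain X' where X': "u ''X'' 0 = int X'" "X' < Q * p ^ e * p" "[X' = X] (mod Q)"
              "[X' = c] (mod p ^ e * p)"
            by blast
          have "[X' = X0] (mod Q)" using X'(3) X(3) by (rule cong_trans)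
          then have "\<exists>X'. u ''X'' 0 = int X' \<and> X' < Q * p ^ Suc e \<and> [X' = X0] (mod Q) \<and>
              [X' = c] (mod p ^ Suc e)"
            using X' by (intro exI[of _ X']) (simp add: mult_ac)
          then show "runs r (''Q'' ::= Mul (var ''Q'') (var ''p'')) u 1 (?I (Suc e))"
            using r u(1) bd e ueq s'(3) eqs s by (intro runs_assign) (simp_all add: mult_ac abs_mult)
        qed
      qed (use r s'(1,3) eqs s bd in \<open>simp_all add: mult_ac abs_mult\<close>)
      then show "e < r \<and> runs r ?body s' (1 + ((2 * r + 1) + 1)) (?I (Suc e))" using e Er by simp
    next
      fix e s'
      assume s': "bounded r s'" "\<And>x. x \<notin> modified ?body \<Longrightarrow> s' x = ?s x" "?I e s'"
        "\<not> bval (Less (var ''q'') (var ''K'')) s'"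
      have "s' ''K'' = s ''K''" using s'(2) by (simp add: match_residue_def)
      then have "\<not> int (p ^ e) < int K" using s'(3,4) s by simp
      then have "\<not> p ^ e < K" by (simp only: of_nat_less_iff not_False_eq_True)
      then have "\<not> e < E" unfolding E(1) using least_exponent(2)[OF p(1)] by blast
      then have "e = E" using s'(3) by simp
      with s'(3) show "?R E s'" by simp
    qed (use r b s E in auto)
  qed (use r in auto)
  then show ?thesis
  proof (rule runs_mono)
    have "r * 1 \<le> r * r" using r(1) by (rule mult_left_mono) simp
    moreover have "1 + (r * ((1 + ((2 * r + 1) + 1)) + 1) + 1) = 2 * (r * r) + 4 * r + 2"
      by (simp add: algebra_simps)
    ultimately show "1 + (r * ((1 + ((2 * r + 1) + 1)) + 1) + 1) \<le> 8 * r\<^sup>2"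
      using r(1) unfolding power2_eq_square by linarith
  qed
qed

lemma prod_modulus_le: "m \<le> g \<Longrightarrow> (\<Prod>i<m. modulus K i) \<le> (\<Prod>i<g. modulus K i)"
  by (intro dvd_imp_le prod_dvd_prod_subset prod_pos) (auto simp: modulus_pos)

text \<open>Since the primes are at most \<open>r\<close>, at most \<open>r\<close> candidates are
  tried; each costs O(r) steps of trial division and, if prime, O(r^2) steps for its
  modulus.\<close>

lemma runs_sweep:
  assumes r: "1 \<le> r" "bounded r s"
    and s: "s ''g'' 0 = int g" "s ''K'' 0 = int K"
      "\<And>k. k < g \<Longrightarrow> s ''a'' (s ''j'' 0 * int g + int k) = int (A k)"
    and g: "\<And>k. k < g \<Longrightarrow> nth_prime k \<le> r" "(\<Prod>k<g. modulus K k) \<le> 2 ^ r"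
  shows "runs r sweep s (24 * r ^ 3) (\<lambda>s'. s' ''X'' 0 = int (crt g (modulus K) A) \<and>
    s' ''Q'' 0 = int (\<Prod>k<g. modulus K k) \<and>
    s' ''f'' 0 = of_bool (\<forall>k<g. s ''Z'' (s ''v'' 0 mod int (modulus K k)) \<noteq> 0))"
proof -
  let ?Z = "\<lambda>i. s ''Z'' (s ''v'' 0 mod int (modulus K i)) \<noteq> 0"
  \<comment> \<open>\<open>R k\<close> describes the results for the first \<open>k\<close> moduli;
    \<open>I n\<close> adds that the numbers up to \<open>n + 1\<close> have been tested and contain
    exactly the first \<open>k\<close> primes.\<close>
  define R where "R k s' \<longleftrightarrow> s' ''k'' 0 = int k \<and> s' ''Q'' 0 = int (\<Prod>i<k. modulus K i) \<and>
    (\<exists>X. s' ''X'' 0 = int X \<and> X < (\<Prod>i<k. modulus K i) \<and> (\<forall>i<k. [X = A i] (mod modulus K i))) \<and>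
    s' ''f'' 0 = of_bool (\<forall>i<k. ?Z i)" for k and s' :: state
  define I where "I n s' \<longleftrightarrow> s' ''p'' 0 = int (n + 1) \<and>
    (\<exists>k\<le>g. (\<forall>i<k. nth_prime i \<le> n + 1) \<and> n + 1 < nth_prime k \<and> R k s')" for n and s' :: state
  let ?tail = "If (Equal (Cell ''Z'' (Rem (var ''v'') (var ''q''))) (Num 0)) (''f'' ::= Num 0) Skip ;;
          ''k'' ::= Add (var ''k'') (Num 1)"
  let ?if = "If (Equal (var ''d'') (var ''p'')) (add_modulus ;; ?tail) Skip"
  let ?body = "''p'' ::= Add (var ''p'') (Num 1) ;; find_divisor ;; ?if"
  have two: "1 \<le> (2::int) ^ r" by simp
  have tail: "runs r ?tail u 3 (R (Suc k))"
    if u: "bounded r u" "k < g" "u ''k'' 0 = int k" "u ''q'' 0 = int (modulus K k)"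
      "u ''Q'' 0 = int (\<Prod>i<Suc k. modulus K i)"
      "\<exists>X. u ''X'' 0 = int X \<and> X < (\<Prod>i<Suc k. modulus K i) \<and> (\<forall>i<Suc k. [X = A i] (mod modulus K i))"
      "u ''f'' 0 = of_bool (\<forall>i<k. ?Z i)" "u ''Z'' = s ''Z''" "u ''v'' = s ''v''" for u k
  proof -
    \<comment> \<open>The counter is smaller than a prime that fits, so its increment fits as
      well.\<close>
    have "k < nth_prime k"
      by (induction k) (use nth_prime_ge_2[of 0] nth_prime_less_iff in \<open>auto intro: less_trans_Suc\<close>)
    then have k: "int k + 1 \<le> 2 ^ r" using g(1)[OF u(2)] int_le_two_power[of "Suc k" r] by simp
    have "runs r ?tail u ((1 + 1) + 1) (R (Suc k))"
    proof (rule runs_Seq[where P = "\<lambda>u'. u' ''f'' 0 = of_bool (\<forall>i<Suc k. ?Z i)"])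
      show "runs r (If (Equal (Cell ''Z'' (Rem (var ''v'') (var ''q''))) (Num 0)) (''f'' ::= Num 0)
          Skip) u (1 + 1)
          (\<lambda>u'. u' ''f'' 0 = of_bool (\<forall>i<Suc k. ?Z i))"
        by (rule runs_If; (rule runs_assign runs_Skip)?) (use r u in \<open>auto simp: less_Suc_eq\<close>)
    next
      fix w
      assume w: "bounded r w" "\<And>x. x \<notin> modified (If (Equal (Cell ''Z'' (Rem (var ''v'') (var ''q'')))
          (Num 0))
          (''f'' ::= Num 0) Skip) \<Longrightarrow> w x = u x" "w ''f'' 0 = of_bool (\<forall>i<Suc k. ?Z i)"
      have "w ''k'' = u ''k''" "w ''Q'' = u ''Q''" "w ''X'' = u ''X''" using w(2) by simp_all
      then show "runs r (''k'' ::= Add (var ''k'') (Num 1)) w 1 (R (Suc k))"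
        unfolding R_def using r u w(1,3) k by (intro runs_assign) (simp_all add: add.commute)
    qed
    then show ?thesis by (rule runs_mono) auto
  qed
  have body: "n < r \<and> runs r ?body s' (17 * r\<^sup>2) (I (Suc n))"
    if s': "bounded r s'" "\<And>x. x \<notin> modified ?body \<Longrightarrow> s' x = s x" "I n s'"
      "bval (Less (var ''k'') (var ''g'')) s'" for n s'
  proof -
    have eqs: "s' ''K'' = s ''K''" "s' ''a'' = s ''a''" "s' ''j'' = s ''j''" "s' ''g'' = s ''g''"
      "s' ''Z'' = s ''Z''" "s' ''v'' = s ''v''"
      using s'(2) by (simp_all add: find_divisor_def add_modulus_def match_residue_def)
    from s'(3) obtain k where k: "s' ''p'' 0 = int (n + 1)" "\<forall>i<k. nth_prime i \<le> n + 1"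
        "n + 1 < nth_prime k"
      "R k s'" unfolding I_def by blast
    have kg: "k < g" using s'(4) k(4) eqs s by (simp add: R_def)
    have n: "n + 2 \<le> r" using k(3) g(1)[OF kg] by simp
    then have nr: "int n + 2 \<le> 2 ^ r" using int_le_two_power[of "n + 2" r] by simp
    have prime: "prime (n + 2) \<longleftrightarrow> n + 2 = nth_prime k"
      using prime_Suc_iff_nth_prime[of k "n + 1"] k(2,3) by simp
    have "runs r ?body s' (1 + (4 * r + ((8 * r\<^sup>2 + 3) + 1))) (I (Suc n))"
    proof (rule runs_assign_Seq)
      let ?t = "upd s' ''p'' (aval (Num 0) s') (aval (Add (var ''p'') (Num 1)) s')"
      assume bt: "bounded r ?t"
      show "runs r (find_divisor ;; ?if) ?t (4 * r + ((8 * r\<^sup>2 + 3) + 1)) (I (Suc n))"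
      proof (rule runs_Seq)
        show "runs r find_divisor ?t (4 * r) (\<lambda>s'. s' ''d'' 0 = int (n + 2) \<longleftrightarrow> prime (n + 2))"
          by (rule runs_find_divisor) (use r bt k n in auto)
      next
        fix u
        assume u: "bounded r u" "\<And>x. x \<notin> modified find_divisor \<Longrightarrow> u x = ?t x"
          "u ''d'' 0 = int (n + 2) \<longleftrightarrow> prime (n + 2)"
        have "u x = ?t x" if "x \<noteq> ''d''" for x using u(2) that by (simp add: find_divisor_def)
        then have ueq: "u ''p'' 0 = int (n + 2)" "u ''k'' = s' ''k''" "u ''Q'' = s' ''Q''"
            "u ''X'' = s' ''X''"
          "u ''f'' = s' ''f''" "u ''K'' = s ''K''" "u ''a'' = s ''a''" "u ''j'' = s ''j''"
              "u ''g'' = s ''g''"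
          "u ''Z'' = s ''Z''" "u ''v'' = s ''v''"
          using k(1) eqs by simp_all
        have Rk: "R k u" using k(4) ueq by (simp add: R_def)
        show "runs r ?if u ((8 * r\<^sup>2 + 3) + 1) (I (Suc n))"
        proof (rule runs_If)
          assume "bval (Equal (var ''d'') (var ''p'')) u"
          then have p: "nth_prime k = n + 2" using u(3) ueq(1) prime by simp
          from Rk obtain X where X: "u ''X'' 0 = int X" "X < (\<Prod>i<k. modulus K i)"
            "\<forall>i<k. [X = A i] (mod modulus K i)" unfolding R_def by blast
          have mod: "(n + 2) ^ least_exponent K (n + 2) = modulus K k" by (simp add: modulus_def p)
          have prod: "(\<Prod>i<k. modulus K i) * modulus K k = (\<Prod>i<Suc k. modulus K i)" by simp
          have cop: "coprime (\<Prod>i<k. modulus K i) (n + 2)"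
          proof (rule prod_coprime_left)
            fix i assume "i \<in> {..<k}"
            then have "nth_prime i \<noteq> nth_prime k" by (intro less_imp_neq) simp
            then have "coprime (nth_prime i) (nth_prime k)"
              by (intro primes_coprime prime_nth_prime)
            then show "coprime (modulus K i) (n + 2)" by (simp add: modulus_def p)
          qed
          show "runs r (add_modulus ;; ?tail) u (8 * r\<^sup>2 + 3) (I (Suc n))"
          proof (rule runs_Seq)
            show "runs r add_modulus u (8 * r\<^sup>2) (\<lambda>s'. s' ''q'' 0 = int ((n + 2)
                ^ least_exponent K (n + 2)) \<and>
              s' ''Q'' 0 = int ((\<Prod>i<k. modulus K i) * (n + 2) ^ least_exponent K (n + 2)) \<and>
              (\<exists>X'. s' ''X'' 0 = int X' \<and> X' < (\<Prod>i<k. modulus K i) * (n + 2) ^ least_exponent K (n + 2) \<and>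
                [X' = X] (mod (\<Prod>i<k. modulus K i)) \<and> [X' = A k] (mod (n + 2) ^ least_exponent K (n + 2))))"
            proof (rule runs_add_modulus)
              show "u ''Q'' 0 = int (\<Prod>i<k. modulus K i)" using Rk by (simp add: R_def)
              show "u ''a'' (u ''j'' 0 * u ''g'' 0 + u ''k'' 0) = int (A k)"
                using Rk ueq s kg by (simp add: R_def)
              show "(\<Prod>i<k. modulus K i) * (n + 2) ^ least_exponent K (n + 2) \<le> 2 ^ r"
                unfolding mod prod using prod_modulus_le[of "Suc k" g K] kg g(2) by simp
            qed (use r u ueq s n X cop in auto)
          next
            fix w
            assume w: "bounded r w" "\<And>x. x \<notin> modified add_modulus \<Longrightarrow> w x = u x"
              "w ''q'' 0 = int ((n + 2) ^ least_exponent K (n + 2)) \<and>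
              w ''Q'' 0 = int ((\<Prod>i<k. modulus K i) * (n + 2) ^ least_exponent K (n + 2)) \<and>
              (\<exists>X'. w ''X'' 0 = int X' \<and> X' < (\<Prod>i<k. modulus K i) * (n + 2) ^ least_exponent K (n + 2) \<and>
                [X' = X] (mod (\<Prod>i<k. modulus K i)) \<and> [X' = A k] (mod (n + 2) ^ least_exponent K (n + 2)))"
            have "w x = u x" if "x \<notin> {''q'', ''Q'', ''X''}" for x
              using w(2) that by (simp add: add_modulus_def match_residue_def)
            then have weq: "w ''p'' = u ''p''" "w ''k'' = u ''k''" "w ''f'' = u ''f''"
                "w ''Z'' = u ''Z''" "w ''v'' = u ''v''"
              by simp_all
            from w(3) obtain X' where X': "w ''X'' 0 = int X'" "X' < (\<Prod>i<Suc k. modulus K i)"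
              "[X' = X] (mod (\<Prod>i<k. modulus K i))" "[X' = A k] (mod modulus K k)"
              unfolding mod prod by blast
            have "[X' = A i] (mod modulus K i)" if "i < Suc k" for i
            proof (cases "i = k")
              case False
              with that have i: "i < k" by simp
              have "[X' = X] (mod modulus K i)"
                using X'(3) by (rule cong_dvd_modulus_nat) (use i in \<open>auto intro: dvd_prodI\<close>)
              also have "[X = A i] (mod modulus K i)" using X(3) i by simp
              finally show ?thesis .
            qed (use X' in simp)
            with X' have ex: "\<exists>X. w ''X'' 0 = int X \<and> X < (\<Prod>i<Suc k. modulus K i) \<and>
                (\<forall>i<Suc k. [X = A i] (mod modulus K i))"
              by blast
            \<comment> \<open>\<open>R\<close> says nothing about \<open>''p''\<close>, which
              \<open>I\<close> needs; the frame property supplies it.\<close>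
            have "runs r ?tail w 3 (\<lambda>s'. s' ''p'' = w ''p'' \<and> R (Suc k) s')"
            proof -
              have "runs r ?tail w 3 (R (Suc k))"
              proof (rule tail)
                show "w ''Q'' 0 = int (\<Prod>i<Suc k. modulus K i)" using w(3) unfolding mod prod by blast
                show "w ''q'' 0 = int (modulus K k)" using w(3) unfolding mod by blast
              qed (use w(1) kg ex weq ueq Rk in \<open>simp_all add: R_def\<close>)
              then show ?thesis
                unfolding runs_def using exec_not_modified[where c = ?tail and x = "''p''"] by fastforce
            qed
            then show "runs r ?tail w 3 (I (Suc n))"
            proof (rule runs_mono)
              fix z assume z: "z ''p'' = w ''p'' \<and> R (Suc k) z"
              have "\<forall>i<Suc k. nth_prime i \<le> Suc n + 1" using k(2) p by (auto simp: less_Suc_eq)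
              moreover have "Suc n + 1 < nth_prime (Suc k)" using p nth_prime_less_iff[of k "Suc k"] by simp
              ultimately show "I (Suc n) z" unfolding I_def using z weq ueq kg
                  by (intro conjI exI[of _ "Suc k"]) auto
            qed simp
          qed
        next
          assume "\<not> bval (Equal (var ''d'') (var ''p'')) u"
          then have "n + 2 \<noteq> nth_prime k" using u(3) ueq(1) prime by simp
          then have "Suc n + 1 < nth_prime k" using k(3) by simp
          moreover have "\<forall>i<k. nth_prime i \<le> Suc n + 1" using k(2) by (auto intro: le_SucI)
          ultimately have "I (Suc n) u" unfolding I_def using Rk ueq kg by (intro conjI exI[of _ k]) auto
          then have "runs r Skip u 1 (I (Suc n))" using r u by (intro runs_Skip)
          then show "runs r Skip u (8 * r\<^sup>2 + 3) (I (Suc n))" by (rule runs_mono) auto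
        qed (use r u in auto)
      qed
    qed (use r s' k nr in auto)
    then have "runs r ?body s' (17 * r\<^sup>2) (I (Suc n))"
    proof (rule runs_mono)
      have "r * 1 \<le> r * r" "1 * 1 \<le> r * r" using r(1) by (auto intro!: mult_le_mono)
      then show "1 + (4 * r + ((8 * r\<^sup>2 + 3) + 1)) \<le> 17 * r\<^sup>2"
        unfolding power2_eq_square by linarith
    qed
    then show ?thesis using n by simp
  qed
  let ?post = "\<lambda>s'. s' ''X'' 0 = int (crt g (modulus K) A) \<and> s' ''Q'' 0 = int (\<Prod>k<g. modulus K k) \<and>
    s' ''f'' 0 = of_bool (\<forall>k<g. ?Z k)"
  have "runs r sweep s (1 + (1 + (1 + (1 + (1 + (r * (17 * r\<^sup>2 + 1) + 1)))))) ?post"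
    unfolding sweep_def
  proof (intro runs_assign_Seq)
    let ?t = "upd (upd (upd (upd (upd s ''X'' 0 0) ''Q'' 0 1) ''f'' 0 1) ''k'' 0 0) ''p'' 0 1"
    let ?u = "\<lambda>s x n. upd s x (aval (Num 0) s) (aval (Num n) s)"
    let ?t' = "?u (?u (?u (?u (?u s ''X'' 0) ''Q'' 1) ''f'' 1) ''k'' 0) ''p'' 1"
    assume "bounded r ?t'"
    then have bt: "bounded r ?t" by simp
    have "runs r (While (Less (var ''k'') (var ''g'')) ?body) ?t (r * (17 * r\<^sup>2 + 1) + 1) ?post"
    proof (rule runs_While[where I = I])
      have "1 < nth_prime 0" using nth_prime_ge_2[of 0] by simp
      then show "I 0 ?t" unfolding I_def by (auto intro!: exI[of _ 0] simp: R_def)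
    next
      fix n s'
      assume s': "bounded r s'" "\<And>x. x \<notin> modified ?body \<Longrightarrow> s' x = ?t x" "I n s'"
        "bval (Less (var ''k'') (var ''g'')) s'"
      have "s' x = s x" if "x \<notin> modified ?body" for x
        using that s'(2)[of x] by (auto simp: find_divisor_def add_modulus_def match_residue_def)
      with s' show "n < r \<and> runs r ?body s' (17 * r\<^sup>2) (I (Suc n))" by (intro body) auto
    next
      fix n s'
      assume s': "bounded r s'" "\<And>x. x \<notin> modified ?body \<Longrightarrow> s' x = ?t x" "I n s'"
        "\<not> bval (Less (var ''k'') (var ''g'')) s'"
      have "s' ''g'' = s ''g''" using s'(2)[of "''g''"]
          by (simp add: find_divisor_def add_modulus_def match_residue_def)
      moreover from s'(3) obtain k where k: "k \<le> g" "R k s'" unfolding I_def by blast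
      ultimately have "k = g" using s'(4) s by (simp add: R_def)
      with k have R: "R g s'" by simp
      then obtain X where X: "s' ''X'' 0 = int X" "X < (\<Prod>i<g. modulus K i)"
          "\<forall>i<g. [X = A i] (mod modulus K i)"
        unfolding R_def by blast
      have "crt g (modulus K) A = X" using X by (intro crt_eqI) (auto simp: modulus_pos coprime_modulus)
      with X R show "?post s'" by (simp add: R_def)
    qed (use r bt in auto)
    then show "runs r (While (Less (var ''k'') (var ''g'')) ?body) ?t' (r * (17 * r\<^sup>2 + 1) + 1) ?post"
        by simp
  qed (use r two in auto)
  then show ?thesis
  proof (rule runs_mono)
    have "r * 1 \<le> r * r" using r(1) by (intro mult_le_mono) auto
    then have "r * r * 1 \<le> r * r * r" "1 * 1 \<le> r * r" using r(1) by (auto intro!: mult_le_mono)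
    moreover have "r ^ 3 = r * r * r" by (simp add: power3_eq_cube)
    moreover have "1 + (1 + (1 + (1 + (1 + (r * (17 * r\<^sup>2 + 1) + 1))))) = 17 * (r * r * r) + r + 6"
      by (simp add: power2_eq_square algebra_simps)
    ultimately show "1 + (1 + (1 + (1 + (1 + (r * (17 * r\<^sup>2 + 1) + 1))))) \<le> 24 * r ^ 3"
      using \<open>r * 1 \<le> r * r\<close> r(1) by linarith
  qed
qed

section \<open>The two programs\<close>

definition choose_group :: com where
  "choose_group = ''g'' ::= Num 1 ;; ''u'' ::= Num 0 ;;
    While (Conj (Less (var ''u'') (var ''t'')) (Less (Mul (var ''g'') (var ''t'')) (var ''b'')))
      (''g'' ::= Mul (Num 2) (var ''g'') ;; ''u'' ::= Add (var ''u'') (Num 1))"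

text \<open>Group \<open>j\<close> occupies cells from \<open>j * g \<ge> j\<close> on, so the array can be overwritten in place. The cells
  from \<open>b\<close> on stay 0 and pad the last groups.\<close>

definition encode_level :: com where
  "encode_level = ''K'' ::= Mul (var ''l'') (Mul (var ''M'') (var ''M'')) ;; choose_group ;;
    ''j'' ::= Num 0 ;;
    While (Less (var ''j'') (var ''b''))
      (sweep ;; Assign ''a'' (var ''j'') (var ''X'') ;; ''j'' ::= Add (var ''j'') (Num 1)) ;;
    ''M'' ::= var ''Q'' ;; ''t'' ::= Mul (var ''t'') (var ''g'')"

definition load_row :: com where
  "load_row = ''j'' ::= Num 0 ;;
    While (Less (var ''j'') (var ''b''))
      (Assign ''a'' (var ''j'') (Cell ''x'' (Add (Mul (var ''i'') (var ''b'')) (var ''j''))) ;;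
       ''j'' ::= Add (var ''j'') (Num 1))"

definition encode_row :: com where
  "encode_row = load_row ;; ''t'' ::= Num 1 ;; ''M'' ::= Num 2 ;;
    While (Less (var ''t'') (var ''b'')) encode_level ;;
    Assign ''out'' (var ''i'') (var ''a'')"

definition encoder :: com where
  "encoder = ''i'' ::= Num 0 ;;
    While (Less (var ''i'') (var ''l'')) (encode_row ;; ''i'' ::= Add (var ''i'') (Num 1)) ;;
    ''len'' ::= var ''l''"

text \<open>The first sweep only serves to compute the product \<open>Q\<close> of the moduli. The membership flags in \<open>Z\<close>
  can then be overwritten in place, since downwards from the top the residues of \<open>v\<close> still have their
  old flags.\<close>

definition enumerate_level :: com where
  "enumerate_level = ''K'' ::= Mul (var ''l'') (Mul (var ''M'') (var ''M'')) ;; choose_group ;; sweep ;;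
    ''v'' ::= Mul (var ''l'') (Mul (var ''Q'') (var ''Q'')) ;;
    While (Less (Num 0) (var ''v''))
      (''v'' ::= Sub (var ''v'') (Num 1) ;; sweep ;; Assign ''Z'' (var ''v'') (var ''f'')) ;;
    ''M'' ::= var ''Q'' ;; ''t'' ::= Mul (var ''t'') (var ''g'')"

definition collect :: com where
  "collect = ''v'' ::= Num 0 ;;
    While (Less (var ''v'') (Mul (var ''l'') (Mul (var ''M'') (var ''M''))))
      (If (Equal (Cell ''Z'' (var ''v'')) (Num 0)) Skip
         (Assign ''out'' (var ''len'') (var ''v'') ;; ''len'' ::= Add (var ''len'') (Num 1)) ;;
       ''v'' ::= Add (var ''v'') (Num 1))"

definition enumerator :: com where
  "enumerator = ''Z'' ::= Num 1 ;; ''t'' ::= Num 1 ;; ''M'' ::= Num 2 ;;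
    While (Less (var ''t'') (var ''b'')) enumerate_level ;; collect"

lemma modified_sweep: "modified sweep = {''X'', ''Q'', ''f'', ''k'', ''p'', ''d'', ''q''}"
  by (auto simp: sweep_def find_divisor_def add_modulus_def match_residue_def)

lemma modified_choose_group: "modified choose_group = {''g'', ''u''}"
  by (auto simp: choose_group_def)

lemma runs_choose_group:
  assumes r: "1 \<le> r" "bounded r s" and s: "s ''t'' 0 = int t" "s ''b'' 0 = int b"
    and t: "t \<le> r" "group_size b t \<le> r"
  shows "runs r choose_group s (6 * r) (\<lambda>s'. s' ''g'' 0 = int (group_size b t))"
proof -
  define E where "E = group_exponent b t"
  have E: "E \<le> t" "group_size b t = 2 ^ E" by (simp_all add: E_def group_exponent_le group_size_def)
  let ?I = "\<lambda>e s'. e \<le> E \<and> s' ''g'' 0 = int (2 ^ e) \<and> s' ''u'' 0 = int e"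
  let ?test = "Conj (Less (var ''u'') (var ''t'')) (Less (Mul (var ''g'') (var ''t'')) (var ''b''))"
  let ?body = "''g'' ::= Mul (Num 2) (var ''g'') ;; ''u'' ::= Add (var ''u'') (Num 1)"
  have test: "bval ?test s' \<longleftrightarrow> e < E" if "\<And>x. x \<notin> {''g'', ''u''} \<Longrightarrow> s' x = s x" "?I e s'" for e s'
  proof -
    have "bval ?test s' \<longleftrightarrow> int e < int t \<and> int (2 ^ e * t) < int b"
      using that s by simp
    also have "\<dots> \<longleftrightarrow> e < t \<and> 2 ^ e * t < b" by (simp only: of_nat_less_iff)
    finally show ?thesis using less_group_exponent_iff[of e b t] that(2) by (simp add: E_def)
  qed
  have one: "(1::int) \<le> 2 ^ r" by simp
  have "runs r choose_group s (1 + (1 + (r * ((1 + 1) + 1) + 1))) (\<lambda>s'. s' ''g'' 0 = int (group_size b t))"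
    unfolding choose_group_def
  proof (intro runs_assign_Seq)
    let ?s = "upd (upd s ''g'' 0 1) ''u'' 0 0"
    assume "bounded r (upd (upd s ''g'' (aval (Num 0) s) (aval (Num 1) s)) ''u''
      (aval (Num 0) (upd s ''g'' (aval (Num 0) s) (aval (Num 1) s)))
      (aval (Num 0) (upd s ''g'' (aval (Num 0) s) (aval (Num 1) s))))"
    then have b: "bounded r ?s" by simp
    have "runs r (While ?test ?body) ?s (r * ((1 + 1) + 1) + 1) (\<lambda>s'. s' ''g'' 0 = int (group_size b t))"
    proof (rule runs_While[where I = ?I])
      fix e s'
      assume s': "bounded r s'" "\<And>x. x \<notin> modified ?body \<Longrightarrow> s' x = ?s x" "?I e s'" "bval ?test s'"
      have e: "e < E" using test[of s' e] s' by simp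
      have "2 ^ Suc e \<le> group_size b t" unfolding E(2) using e by (intro power_increasing) auto
      then have "2 ^ Suc e \<le> r" "Suc e \<le> r" using t e E(1) by linarith+
      then have bd: "int (2 ^ Suc e) \<le> 2 ^ r" "int (Suc e) \<le> 2 ^ r"
          by (auto dest: int_le_two_power simp del: of_nat_power of_nat_Suc power_Suc)
      have "runs r ?body s' (1 + 1) (?I (Suc e))"
        by (intro runs_assign_Seq runs_assign) (use r s' e bd in auto)
      then show "e < r \<and> runs r ?body s' (1 + 1) (?I (Suc e))" using e E t by simp
    next
      fix e s'
      assume s': "bounded r s'" "\<And>x. x \<notin> modified ?body \<Longrightarrow> s' x = ?s x" "?I e s'" "\<not> bval ?test s'"
      then have "\<not> e < E" using test[of s' e] by auto
      then have "e = E" using s'(3) by simp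
      then show "s' ''g'' 0 = int (group_size b t)" using s'(3) E by simp
    qed (use r b in auto)
    then show "runs r (While ?test ?body) (upd (upd s ''g'' (aval (Num 0) s) (aval (Num 1) s)) ''u''
      (aval (Num 0) (upd s ''g'' (aval (Num 0) s) (aval (Num 1) s)))
      (aval (Num 0) (upd s ''g'' (aval (Num 0) s) (aval (Num 1) s)))) (r * ((1 + 1) + 1) + 1)
      (\<lambda>s'. s' ''g'' 0 = int (group_size b t))" by simp
  qed (use r one in auto)
  then show ?thesis by (rule runs_mono) (use r in auto)
qed

text \<open>By l \<le> 2 ^ l the bound l ^ (24 b^2 + 1) on inner products becomes 2 ^ (l (24 b^2 +
  1)); the factor 40 leaves room. It also covers the primes: groups are smaller than 2 b, so primes
  are at most 4 (2 b)^2 = 16 b^2.\<close>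

definition bits :: "nat \<Rightarrow> nat \<Rightarrow> nat" where
  "bits b l = 40 * b\<^sup>2 * l"

context
  fixes b l r :: nat
  assumes b: "3 \<le> b" and l: "16 \<le> l" and r_def: "r = bits b l"
begin

lemma bits_bounds:
  shows "1 \<le> r" and "2 * b \<le> r" and "l \<le> r" and "16 * b\<^sup>2 \<le> r"
proof -
  have "1 * 1 \<le> b\<^sup>2 * l" using b l by (intro mult_le_mono) auto
  then show "1 \<le> r" by (simp add: r_def bits_def)
  have "16 * b\<^sup>2 * 1 \<le> 40 * b\<^sup>2 * l" using l by (intro mult_le_mono) auto
  then show 1: "16 * b\<^sup>2 \<le> r" by (simp add: r_def bits_def)
  have "2 * b \<le> 16 * b\<^sup>2" using b by (simp add: power2_eq_square)
  with 1 show "2 * b \<le> r" by simp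
  have "1 * l \<le> 40 * b\<^sup>2 * l" using b by (intro mult_le_mono1) (simp add: Suc_le_eq)
  then show "l \<le> r" by (simp add: r_def bits_def)
qed

lemma dot_bound_bits:
  assumes "i \<le> depth b"
  shows "dot_bound b l i \<le> 2 ^ r" and "code_bound b l i \<le> 2 ^ r"
proof -
  have "dot_bound b l i \<le> l * (l ^ (12 * b\<^sup>2))\<^sup>2"
    unfolding dot_bound_def using assms b l by (intro mult_left_mono power_mono code_bound_le_poly) auto
  also have "\<dots> = l ^ (24 * b\<^sup>2 + 1)" by (simp flip: power_mult)
  also have "\<dots> \<le> (2 ^ l) ^ (24 * b\<^sup>2 + 1)" using less_exp[of l] by (intro power_mono) auto
  also have "\<dots> = 2 ^ (l * (24 * b\<^sup>2 + 1))" by (simp only: power_mult)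
  also have "\<dots> \<le> 2 ^ r"
  proof (rule power_increasing)
    have "1 \<le> b\<^sup>2" using b by simp
    then have "24 * b\<^sup>2 + 1 \<le> 40 * b\<^sup>2" by linarith
    then have "l * (24 * b\<^sup>2 + 1) \<le> l * (40 * b\<^sup>2)" by (rule mult_left_mono) simp
    then show "l * (24 * b\<^sup>2 + 1) \<le> r" by (simp add: r_def bits_def mult_ac)
  qed simp
  finally show 1: "dot_bound b l i \<le> 2 ^ r" .
  have "1 * code_bound b l i * 1 \<le> l * code_bound b l i * code_bound b l i"
    using l code_bound_pos[of b l i] by (intro mult_le_mono) (auto simp: Suc_le_eq)
  also have "\<dots> = dot_bound b l i" by (simp add: dot_bound_def power2_eq_square)
  finally show "code_bound b l i \<le> 2 ^ r" using 1 by simp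
qed

lemma group_bits:
  assumes "i < depth b"
  shows "groups b i \<le> r" and "block b i \<le> r" and "k < groups b i \<Longrightarrow> nth_prime k \<le> r"
proof -
  have t: "block b i < b" using assms by (simp add: less_depth_iff)
  then show "block b i \<le> r" using bits_bounds by simp
  have "groups b i * 1 \<le> groups b i * block b i" by (intro mult_left_mono) (auto simp: Suc_le_eq)
  also have "\<dots> < 2 * b" using t by (intro group_size_mult_less) auto
  finally have g: "groups b i < 2 * b" by simp
  then show "groups b i \<le> r" using bits_bounds by simp
  assume "k < groups b i"
  with g have "k + 1 \<le> 2 * b" by simp
  then have "4 * (k + 1)\<^sup>2 \<le> 4 * (2 * b)\<^sup>2" by (intro mult_left_mono power_mono) auto
  then show "nth_prime k \<le> r"
    using nth_prime_le[of k] bits_bounds(4) by (simp add: power_mult_distrib)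
qed

definition at_level :: "nat \<Rightarrow> state \<Rightarrow> bool" where
  "at_level i s \<longleftrightarrow> s ''t'' 0 = int (block b i) \<and> s ''M'' 0 = int (code_bound b l i)"

lemma runs_level_sweep:
  assumes "bounded r s" "i < depth b"
    and "s ''g'' 0 = int (groups b i)" "s ''K'' 0 = int (dot_bound b l i)"
      "\<And>k. k < groups b i \<Longrightarrow> s ''a'' (s ''j'' 0 * int (groups b i) + int k) = int (A k)"
  shows "runs r sweep s (24 * r ^ 3) (\<lambda>s'.
    s' ''X'' 0 = int (crt (groups b i) (modulus (dot_bound b l i)) A) \<and>
    s' ''Q'' 0 = int (code_bound b l (Suc i)) \<and>
    s' ''f'' 0 = of_bool (\<forall>k<groups b i. s ''Z'' (s ''v'' 0 mod int (modulus (dot_bound b l i) k)) \<noteq> 0))"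
  unfolding code_bound_Suc
  using assms bits_bounds group_bits dot_bound_bits[of "Suc i"]
  by (intro runs_sweep) (auto simp: code_bound_Suc)

text \<open>Both programs begin a level in this way, hence the arbitrary continuation
  \<open>c\<close>.\<close>

lemma runs_level_prefix:
  assumes s: "bounded r s" "s ''b'' 0 = int b" "s ''l'' 0 = int l" "at_level i s" and i: "i < depth b"
    and c: "\<And>s'. bounded r s' \<Longrightarrow> (\<And>x. x \<notin> {''K'', ''g'', ''u''} \<Longrightarrow> s' x = s x) \<Longrightarrow>
      s' ''g'' 0 = int (groups b i) \<Longrightarrow> s' ''K'' 0 = int (dot_bound b l i) \<Longrightarrow> runs r c s' n Q"
  shows "runs r (''K'' ::= Mul (var ''l'') (Mul (var ''M'') (var ''M'')) ;; choose_group ;; c) s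
    (1 + (6 * r + n)) Q"
proof (rule runs_assign_Seq)
  let ?e = "Mul (var ''l'') (Mul (var ''M'') (var ''M''))"
  have K: "aval ?e s = int (dot_bound b l i)"
    using s by (simp add: at_level_def dot_bound_def power2_eq_square)
  have "int (dot_bound b l i) \<le> 2 ^ r"
    using dot_bound_bits[of i] i by (intro int_le_two_power') simp
  then show "\<bar>aval ?e s\<bar> \<le> 2 ^ r" unfolding K by simp
  let ?t = "upd s ''K'' (aval (Num 0) s) (aval ?e s)"
  assume bt: "bounded r ?t"
  show "runs r (choose_group ;; c) ?t (6 * r + n) Q"
  proof (rule runs_Seq)
    show "runs r choose_group ?t (6 * r) (\<lambda>s'. s' ''g'' 0 = int (groups b i))"
      by (rule runs_choose_group) (use bits_bounds group_bits[OF i] s bt in \<open>auto simp: at_level_def\<close>)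
  next
    fix u
    assume u: "bounded r u" "\<And>x. x \<notin> modified choose_group \<Longrightarrow> u x = ?t x" "u ''g'' 0 = int (groups b i)"
    have "u ''K'' = ?t ''K''" using u(2) by (simp add: modified_choose_group)
    then have "u ''K'' 0 = int (dot_bound b l i)" using K by simp
    moreover have "u x = s x" if "x \<notin> {''K'', ''g'', ''u''}" for x
      using u(2)[of x] that by (auto simp: modified_choose_group)
    ultimately show "runs r c u n Q" using u by (intro c) auto
  qed
qed (use bits_bounds s in auto)

lemma runs_level_suffix:
  assumes "bounded r s" "i < depth b" "s ''t'' 0 = int (block b i)" "s ''g'' 0 = int (groups b i)"
    "s ''Q'' 0 = int (code_bound b l (Suc i))"
    "\<And>s'. at_level (Suc i) s' \<Longrightarrow> (\<And>x. x \<notin> {''M'', ''t''} \<Longrightarrow> s' x = s x) \<Longrightarrow> R s'"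
  shows "runs r (''M'' ::= var ''Q'' ;; ''t'' ::= Mul (var ''t'') (var ''g'')) s 2 R"
proof -
  have "block b (Suc i) \<le> r" using block_less[of b "Suc i"] assms(2) b bits_bounds(2) by simp
  then have "int (block b (Suc i)) \<le> 2 ^ r" by (rule int_le_two_power)
  moreover have "int (code_bound b l (Suc i)) \<le> 2 ^ r"
    using dot_bound_bits[of "Suc i"] assms(2) by (intro int_le_two_power') simp
  ultimately have "runs r (''M'' ::= var ''Q'' ;; ''t'' ::= Mul (var ''t'') (var ''g'')) s (1 + 1) R"
    by (intro runs_assign_Seq runs_assign assms(6))
      (use bits_bounds assms(1-5) in \<open>auto simp: at_level_def\<close>)
  then show ?thesis by (rule runs_mono) auto
qed

section \<open>Verification of the encoder\<close>

lemma runs_encode_level: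
  assumes A: "\<And>j. A j < 2" "\<And>j. b \<le> j \<Longrightarrow> A j = 0"
    and s: "bounded r s" "s ''b'' 0 = int b" "s ''l'' 0 = int l" "at_level i s"
      "\<And>j. s ''a'' (int j) = int (code b l i A j)"
    and i: "i < depth b"
  shows "runs r encode_level s (40 * r ^ 4)
    (\<lambda>s'. at_level (Suc i) s' \<and> (\<forall>j. s' ''a'' (int j) = int (code b l (Suc i) A j)))"
proof -
  let ?R = "\<lambda>s'. at_level (Suc i) s' \<and> (\<forall>j. s' ''a'' (int j) = int (code b l (Suc i) A j))"
  let ?body = "sweep ;; Assign ''a'' (var ''j'') (var ''X'') ;; ''j'' ::= Add (var ''j'') (Num 1)"
  let ?loop = "While (Less (var ''j'') (var ''b'')) ?body"
  let ?suffix = "''M'' ::= var ''Q'' ;; ''t'' ::= Mul (var ''t'') (var ''g'')"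
  \<comment> \<open>\<open>''Q''\<close> is meaningful only after a sweep at this level, hence the
    guard \<open>0 < n\<close>; it is satisfied on leaving the loop because \<open>b\<close> is
    positive.\<close>
  define I where "I n s' \<longleftrightarrow> n \<le> b \<and> s' ''j'' 0 = int n \<and> (0 < n \<longrightarrow> s' ''Q'' 0 = int (code_bound b l (Suc
      i))) \<and>
    (\<forall>m. s' ''a'' (int m) = int (code b l (if m < n then Suc i else i) A m))" for n and s' :: state
  have "runs r encode_level s (1 + (6 * r + (1 + ((r * ((24 * r ^ 3 + (1 + 1)) + 1) + 1) + 2)))) ?R"
    unfolding encode_level_def
  proof (rule runs_level_prefix[OF s(1-4) i])
    fix u
    assume u: "bounded r u" "\<And>x. x \<notin> {''K'', ''g'', ''u''} \<Longrightarrow> u x = s x"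
      "u ''g'' 0 = int (groups b i)" "u ''K'' 0 = int (dot_bound b l i)"
    have ueq: "u ''a'' = s ''a''" "u ''b'' = s ''b''" "u ''t'' = s ''t''" using u(2) by simp_all
    show "runs r (''j'' ::= Num 0 ;; ?loop ;; ?suffix) u
        (1 + ((r * ((24 * r ^ 3 + (1 + 1)) + 1) + 1) + 2)) ?R"
    proof (rule runs_assign_Seq)
      let ?u = "upd u ''j'' (aval (Num 0) u) (aval (Num 0) u)"
      assume bu: "bounded r ?u"
      show "runs r (?loop ;; ?suffix) ?u ((r * ((24 * r ^ 3 + (1 + 1)) + 1) + 1) + 2) ?R"
      proof (rule runs_Seq)
        show "runs r ?loop ?u (r * ((24 * r ^ 3 + (1 + 1)) + 1) + 1) (I b)"
        proof (rule runs_While[where I = I])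
          show "I 0 ?u" using s ueq by (simp add: I_def)
        next
          fix n w
          assume w: "bounded r w" "\<And>x. x \<notin> modified ?body \<Longrightarrow> w x = ?u x" "I n w"
            "bval (Less (var ''j'') (var ''b'')) w"
          have weq: "w ''g'' = u ''g''" "w ''K'' = u ''K''" "w ''b'' = u ''b''"
            using w(2) by (simp_all add: modified_sweep)
          have n: "n < b" using w(3,4) weq ueq s(2) by (simp add: I_def)
          have "runs r ?body w (24 * r ^ 3 + (1 + 1)) (I (Suc n))"
          proof (rule runs_Seq)
            have "n * 1 \<le> n * groups b i" by (intro mult_left_mono) (simp_all add: Suc_le_eq)
            then have le: "\<not> n * groups b i + k < n" for k by linarith
            show "runs r sweep w (24 * r ^ 3) (\<lambda>s'.
                s' ''X'' 0 = int (crt (groups b i) (modulus (dot_bound b l i))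
                    (\<lambda>k. code b l i A (n * groups b i + k))) \<and>
                s' ''Q'' 0 = int (code_bound b l (Suc i)) \<and>
                s' ''f'' 0 = of_bool (\<forall>k<groups b i. w ''Z'' (w ''v'' 0 mod int (modulus (dot_bound b l
                    i) k)) \<noteq> 0))"
            proof (rule runs_level_sweep)
              fix k
              have "w ''j'' 0 * int (groups b i) + int k = int (n * groups b i + k)" using w(3)
                  by (simp add: I_def)
              moreover have "w ''a'' (int (n * groups b i + k)) = int (code b l i A (n * groups b i + k))"
                using w(3) le[of k] unfolding I_def by (simp del: of_nat_add of_nat_mult)
              ultimately show "w ''a'' (w ''j'' 0 * int (groups b i) + int k) = int (code b l i A (n *
                  groups b i + k))"
                by (simp only:)
            qed (use w u weq i in auto)
          next
            fix z
            assume z: "bounded r z" "\<And>x. x \<notin> modified sweep \<Longrightarrow> z x = w x"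
              "z ''X'' 0 = int (crt (groups b i) (modulus (dot_bound b l i))
                  (\<lambda>k. code b l i A (n * groups b i + k))) \<and>
                z ''Q'' 0 = int (code_bound b l (Suc i)) \<and>
                z ''f'' 0 = of_bool (\<forall>k<groups b i. w ''Z'' (w ''v'' 0 mod int (modulus (dot_bound b l
                    i) k)) \<noteq> 0)"
            have zeq: "z ''j'' = w ''j''" "z ''a'' = w ''a''" using z(2) by (simp_all add: modified_sweep)
            have X: "z ''X'' 0 = int (code b l (Suc i) A n)" using z(3) by simp
            have "code b l (Suc i) A n \<le> 2 ^ r"
              using code_less[of A b l "Suc i" n] A(1) dot_bound_bits(2)[of "Suc i"] i by simp
            then have "int (code b l (Suc i) A n) \<le> 2 ^ r" by (rule int_le_two_power')
            moreover have "int n + 1 \<le> 2 ^ r"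
              using int_le_two_power[of "Suc n" r] n bits_bounds(2) by simp
            ultimately show "runs r (Assign ''a'' (var ''j'') (var ''X'') ;; ''j'' ::= Add (var ''j'')
                (Num 1)) z (1 + 1) (I (Suc n))"
              by (intro runs_assign_Seq runs_assign)
                (use bits_bounds z X zeq w(3) n in \<open>auto simp: I_def less_Suc_eq simp del: code.simps\<close>)
          qed
          then show "n < r \<and> runs r ?body w (24 * r ^ 3 + (1 + 1)) (I (Suc n))" using n bits_bounds by simp
        next
          fix n w
          assume w: "bounded r w" "\<And>x. x \<notin> modified ?body \<Longrightarrow> w x = ?u x" "I n w"
            "\<not> bval (Less (var ''j'') (var ''b'')) w"
          have "w ''b'' = u ''b''" using w(2) by (simp add: modified_sweep)
          then have "n = b" using w(3,4) ueq s(2) by (simp add: I_def)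
          with w(3) show "I b w" by simp
        qed (use bits_bounds bu in auto)
      next
        fix w
        assume w: "bounded r w" "\<And>x. x \<notin> modified ?loop \<Longrightarrow> w x = ?u x" "I b w"
        have weq: "w ''g'' = u ''g''" "w ''t'' = u ''t''" using w(2) by (simp_all add: modified_sweep)
        \<comment> \<open>The loop rewrites only cells below \<open>b\<close>; from \<open>b\<close>
          on the codes of both levels are 0, so the old contents are also the new ones.\<close>
        have zero: "code b l i' A m = 0" if "b \<le> m" for m i'
        proof (rule code_eq_0)
          show "b \<le> m * block b i'"
            using mult_le_mono[OF that, of 1 "block b i'"] by (simp add: Suc_le_eq)
        qed (rule A(2))
        have a: "w ''a'' (int m) = int (code b l (Suc i) A m)" for m
          using w(3) zero[of m i] zero[of m "Suc i"]
              by (cases "m < b") (auto simp: I_def simp del: code.simps)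
        show "runs r ?suffix w 2 ?R"
          using w i u weq ueq s(4) a b by (intro runs_level_suffix[of _ i])
              (auto simp: I_def at_level_def simp del: code.simps)
      qed
    qed (use bits_bounds u in auto)
  qed
  then show ?thesis
  proof (rule runs_mono)
    have r: "1 \<le> r" by (rule bits_bounds)
    have "r ^ 1 \<le> r ^ 4" "r ^ 0 \<le> r ^ 4" using r by (intro power_increasing; simp)+
    moreover have "1 + (6 * r + (1 + ((r * ((24 * r ^ 3 + (1 + 1)) + 1) + 1) + 2)))
        = 24 * r ^ 4 + 9 * r + 5"
      by (simp add: algebra_simps power4_eq_xxxx power3_eq_cube)
    ultimately show "1 + (6 * r + (1 + ((r * ((24 * r ^ 3 + (1 + 1)) + 1) + 1) + 2))) \<le> 40 * r ^ 4"
      by simp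
  qed
qed

lemma runs_load_row:
  assumes s: "bounded r s" "s ''b'' 0 = int b" "s ''i'' 0 = int c"
    "\<And>n. n < b * l \<Longrightarrow> s ''x'' (int n) = x ! n" "\<And>j. b \<le> j \<Longrightarrow> s ''a'' (int j) = 0"
    and x: "x \<in> vecs {0, 1} (b * l)" and c: "c < l"
  shows "runs r load_row s (5 * r) (\<lambda>s'. \<forall>j. s' ''a'' (int j) = int (row b x c j))"
proof -
  define I where "I n s' \<longleftrightarrow> n \<le> b \<and> s' ''j'' 0 = int n \<and>
    (\<forall>j. (j < n \<or> b \<le> j) \<longrightarrow> s' ''a'' (int j) = int (row b x c j))" for n and s' :: state
  let ?body = "Assign ''a'' (var ''j'') (Cell ''x'' (Add (Mul (var ''i'') (var ''b'')) (var ''j''))) ;;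
       ''j'' ::= Add (var ''j'') (Num 1)"
  have "runs r load_row s (1 + (r * ((1 + 1) + 1) + 1)) (\<lambda>s'. \<forall>j. s' ''a'' (int j) = int (row b x c j))"
    unfolding load_row_def
  proof (rule runs_assign_Seq)
    let ?s = "upd s ''j'' (aval (Num 0) s) (aval (Num 0) s)"
    assume bs: "bounded r ?s"
    show "runs r (While (Less (var ''j'') (var ''b'')) ?body) ?s (r * ((1 + 1) + 1) + 1)
      (\<lambda>s'. \<forall>j. s' ''a'' (int j) = int (row b x c j))"
    proof (rule runs_While[where I = I])
      show "I 0 ?s" using s by (simp add: I_def row_def)
    next
      fix n u
      assume u: "bounded r u" "\<And>x. x \<notin> modified ?body \<Longrightarrow> u x = ?s x" "I n u"
          "bval (Less (var ''j'') (var ''b'')) u"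
      have ueq: "u ''b'' = s ''b''" "u ''x'' = s ''x''" "u ''i'' = s ''i''" using u(2) by simp_all
      have n: "n < b" using u(3,4) ueq s by (simp add: I_def)
      have idx: "c * b + n < b * l" using c n by (rule row_index_less)
      then have "s ''x'' (int (c * b + n)) = x ! (c * b + n)" by (rule s(4))
      moreover have "x ! (c * b + n) = 0 \<or> x ! (c * b + n) = 1" using x idx by (rule vecs_nth)
      ultimately have v: "s ''x'' (int c * int b + int n) = int (row b x c n)" "row b x c n \<le> 1"
        using n by (auto simp: row_def)
      have "int (row b x c n) \<le> 2 ^ r" using int_le_two_power[of "row b x c n" r] v bits_bounds by simp
      moreover have "1 + int n \<le> 2 ^ r" using int_le_two_power[of "Suc n" r] n bits_bounds(2) by simp
      ultimately have "runs r ?body u (1 + 1) (I (Suc n))"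
        by (intro runs_assign_Seq runs_assign)
          (use bits_bounds u(1,3) ueq s(2,3) v n in \<open>auto simp: I_def less_Suc_eq\<close>)
      then show "n < r \<and> runs r ?body u (1 + 1) (I (Suc n))" using n bits_bounds by simp
    next
      fix n u
      assume u: "bounded r u" "\<And>x. x \<notin> modified ?body \<Longrightarrow> u x = ?s x" "I n u" "\<not> bval (Less (var ''j'')
          (var ''b'')) u"
      have "u ''b'' = s ''b''" using u(2) by simp
      then have "n = b" using u(3,4) s by (simp add: I_def)
      then show "\<forall>j. u ''a'' (int j) = int (row b x c j)" using u(3) unfolding I_def by (metis not_le)
    qed (use bits_bounds bs in auto)
  qed (use bits_bounds s in auto)
  then show ?thesis by (rule runs_mono) (use bits_bounds in auto)
qed

lemma modified_encode_level:
  "modified encode_level = {''K'', ''g'', ''u'', ''j'', ''a'', ''M'', ''t''} \<union> modified sweep"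
  by (auto simp: encode_level_def modified_choose_group)

lemma at_level_0: "s ''t'' 0 = 1 \<Longrightarrow> s ''M'' 0 = 2 \<Longrightarrow> at_level 0 s"
  by (simp add: at_level_def)

lemma at_level_test:
  "at_level i s \<Longrightarrow> s ''b'' 0 = int b \<Longrightarrow> bval (Less (var ''t'') (var ''b'')) s \<longleftrightarrow> i < depth b"
  by (simp add: at_level_def less_depth_iff)

lemma depth_less_bits: "i < depth b \<Longrightarrow> i < r"
  using depth_le[of i b] bits_bounds(2) b by simp

text \<open>The zeros of \<open>''a''\<close> from \<open>b\<close> on are a precondition and are
  re-established, because the array is reused for the next row and \<open>load_row\<close>
  overwrites only the cells below \<open>b\<close>.\<close>

lemma runs_encode_row:
  assumes s: "bounded r s" "s ''b'' 0 = int b" "s ''l'' 0 = int l" "s ''i'' 0 = int c"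
    "\<And>n. n < b * l \<Longrightarrow> s ''x'' (int n) = x ! n" "\<And>j. b \<le> j \<Longrightarrow> s ''a'' (int j) = 0"
    and x: "x \<in> vecs {0, 1} (b * l)" and c: "c < l"
  shows "runs r encode_row s (50 * r ^ 5) (\<lambda>s'.
    s' ''out'' = (s ''out'')(int c := int (code b l (depth b) (row b x c) 0)) \<and>
    (\<forall>j\<ge>b. s' ''a'' (int j) = 0))"
proof -
  let ?A = "row b x c"
  let ?R = "\<lambda>s'. s' ''out'' = (s ''out'')(int c := int (code b l (depth b) ?A 0)) \<and>
      (\<forall>j\<ge>b. s' ''a'' (int j) = 0)"
  have A: "?A j < 2" for j
    using vecs_nth[OF x row_index_less[OF c, of j b]] by (auto simp: row_def)
  have A0: "?A j = 0" if "b \<le> j" for j using that by (simp add: row_def)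
  define I where "I i s' \<longleftrightarrow> i \<le> depth b \<and> at_level i s' \<and> (\<forall>j. s' ''a'' (int j) = int (code b l i ?A j))"
    for i and s' :: state
  let ?loop = "While (Less (var ''t'') (var ''b'')) encode_level"
  have two: "(2::int) \<le> 2 ^ r" using int_le_two_power[of 2 r] bits_bounds(2) b by simp
  have "runs r encode_row s (5 * r + (1 + (1 + ((r * (40 * r ^ 4 + 1) + 1) + 1)))) ?R"
    unfolding encode_row_def
  proof (rule runs_Seq[OF runs_load_row[OF s(1,2,4,5,6) x c]])
    fix u
    assume u: "bounded r u" "\<And>x. x \<notin> modified load_row \<Longrightarrow> u x = s x" "\<forall>j. u ''a'' (int j) = int (?A j)"
    have ueq: "u ''b'' = s ''b''" "u ''l'' = s ''l''" "u ''i'' = s ''i''" "u ''out'' = s ''out''"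
      using u(2) by (simp_all add: load_row_def)
    let ?u = "upd (upd u ''t'' (aval (Num 0) u) (aval (Num 1) u)) ''M''
      (aval (Num 0) (upd u ''t'' (aval (Num 0) u) (aval (Num 1) u)))
      (aval (Num 2) (upd u ''t'' (aval (Num 0) u) (aval (Num 1) u)))"
    show "runs r (''t'' ::= Num 1 ;; ''M'' ::= Num 2 ;; ?loop ;; Assign ''out'' (var ''i'') (var ''a'')) u
        (1 + (1 + ((r * (40 * r ^ 4 + 1) + 1) + 1))) ?R"
    proof (intro runs_assign_Seq)
      assume bu: "bounded r ?u"
      show "runs r (?loop ;; Assign ''out'' (var ''i'') (var ''a'')) ?u ((r * (40 * r ^ 4 + 1) + 1) + 1) ?R"
      proof (rule runs_Seq)
        show "runs r ?loop ?u (r * (40 * r ^ 4 + 1) + 1) (I (depth b))"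
        proof (rule runs_While[where I = I])
          show "I 0 ?u" using u(3) by (simp add: I_def at_level_0)
        next
          fix i w
          assume w: "bounded r w" "\<And>x. x \<notin> modified encode_level \<Longrightarrow> w x = ?u x" "I i w"
            "bval (Less (var ''t'') (var ''b'')) w"
          have weq: "w ''b'' = s ''b''" "w ''l'' = s ''l''"
            using w(2) ueq by (simp_all add: modified_encode_level modified_sweep)
          then have i: "i < depth b" using w(3,4) s at_level_test[of i w] by (simp add: I_def)
          have "runs r encode_level w (40 * r ^ 4)
              (\<lambda>s'. at_level (Suc i) s' \<and> (\<forall>j. s' ''a'' (int j) = int (code b l (Suc i) ?A j)))"
            using A A0 w i weq s unfolding I_def by (intro runs_encode_level) auto
          then have "runs r encode_level w (40 * r ^ 4) (I (Suc i))"
            using i by (elim runs_mono) (auto simp: I_def simp del: code.simps)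
          then show "i < r \<and> runs r encode_level w (40 * r ^ 4) (I (Suc i))" using i depth_less_bits by simp
        next
          fix i w
          assume w: "bounded r w" "\<And>x. x \<notin> modified encode_level \<Longrightarrow> w x = ?u x" "I i w"
            "\<not> bval (Less (var ''t'') (var ''b'')) w"
          have "w ''b'' = s ''b''" using w(2) ueq by (simp add: modified_encode_level modified_sweep)
          then have "i = depth b" using w(3,4) s at_level_test[of i w] by (simp add: I_def)
          with w(3) show "I (depth b) w" by simp
        qed (use bits_bounds bu in auto)
      next
        fix w
        assume w: "bounded r w" "\<And>x. x \<notin> modified ?loop \<Longrightarrow> w x = ?u x" "I (depth b) w"
        have weq: "w ''i'' = s ''i''" "w ''out'' = s ''out''"
          using w(2) ueq by (simp_all add: modified_encode_level modified_sweep)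
        have zero: "code b l (depth b) ?A m = 0" if "b \<le> m" for m
        proof (rule code_eq_0)
          show "b \<le> m * block b (depth b)"
            using mult_le_mono[OF that, of 1 "block b (depth b)"] by (simp add: Suc_le_eq)
        qed (rule A0)
        have "w ''a'' (int 0) = int (code b l (depth b) ?A 0)" using w(3) unfolding I_def by blast
        moreover have "code b l (depth b) ?A 0 \<le> 2 ^ r"
          using code_less[of ?A b l "depth b" 0] A dot_bound_bits(2)[of "depth b"] by simp
        then have "int (code b l (depth b) ?A 0) \<le> 2 ^ r" by (rule int_le_two_power')
        ultimately show "runs r (Assign ''out'' (var ''i'') (var ''a'')) w 1 ?R"
          using w zero bits_bounds weq s by (intro runs_assign) (auto simp: I_def)
      qed
    qed (use bits_bounds two u in auto)
  qed
  then show ?thesis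
  proof (rule runs_mono)
    have r: "1 \<le> r" by (rule bits_bounds)
    have "r ^ 1 \<le> r ^ 5" "r ^ 0 \<le> r ^ 5" using r by (intro power_increasing; simp)+
    moreover have "5 * r + (1 + (1 + ((r * (40 * r ^ 4 + 1) + 1) + 1))) = 40 * r ^ 5 + 6 * r + 4"
      by (simp add: algebra_simps power_numeral_reduce)
    ultimately show "5 * r + (1 + (1 + ((r * (40 * r ^ 4 + 1) + 1) + 1))) \<le> 50 * r ^ 5"
      by simp
  qed
qed

lemma runs_encoder:
  assumes s: "bounded r s" "s ''b'' 0 = int b" "s ''l'' 0 = int l"
    "\<And>n. n < b * l \<Longrightarrow> s ''x'' (int n) = x ! n" "\<And>j. b \<le> j \<Longrightarrow> s ''a'' (int j) = 0"
    and x: "x \<in> vecs {0, 1} (b * l)"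
  shows "runs r encoder s (60 * r ^ 6)
    (\<lambda>s'. s' ''len'' 0 = int l \<and> (\<forall>c<l. s' ''out'' (int c) = psi b l x ! c))"
proof -
  let ?R = "\<lambda>s'. s' ''len'' 0 = int l \<and> (\<forall>c<l. s' ''out'' (int c) = psi b l x ! c)"
  define I where "I c s' \<longleftrightarrow> c \<le> l \<and> s' ''i'' 0 = int c \<and> (\<forall>j\<ge>b. s' ''a'' (int j) = 0) \<and>
    (\<forall>m<c. s' ''out'' (int m) = psi b l x ! m)" for c and s' :: state
  let ?body = "encode_row ;; ''i'' ::= Add (var ''i'') (Num 1)"
  let ?loop = "While (Less (var ''i'') (var ''l'')) ?body"
  have lr: "int l \<le> 2 ^ r" using bits_bounds by (intro int_le_two_power)
  have mods: "x \<notin> modified encode_row" if "x \<in> {''b'', ''l'', ''x'', ''i''}" for x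
    using that by (auto simp: encode_row_def load_row_def modified_encode_level modified_sweep)
  have "runs r encoder s (1 + ((r * ((50 * r ^ 5 + 1) + 1) + 1) + 1)) ?R"
    unfolding encoder_def
  proof (rule runs_assign_Seq)
    let ?s = "upd s ''i'' (aval (Num 0) s) (aval (Num 0) s)"
    assume bs: "bounded r ?s"
    show "runs r (?loop ;; ''len'' ::= var ''l'') ?s ((r * ((50 * r ^ 5 + 1) + 1) + 1) + 1) ?R"
    proof (rule runs_Seq)
      show "runs r ?loop ?s (r * ((50 * r ^ 5 + 1) + 1) + 1) (I l)"
      proof (rule runs_While[where I = I])
        show "I 0 ?s" using s by (simp add: I_def)
      next
        fix c u
        assume u: "bounded r u" "\<And>x. x \<notin> modified ?body \<Longrightarrow> u x = ?s x" "I c u"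
            "bval (Less (var ''i'') (var ''l'')) u"
        have ueq: "u ''b'' = s ''b''" "u ''l'' = s ''l''" "u ''x'' = s ''x''" using u(2) mods by simp_all
        have c: "c < l" using u(3,4) ueq s by (simp add: I_def)
        have c1: "1 + int c \<le> 2 ^ r" using int_le_two_power[of "Suc c" r] c bits_bounds(3) by simp
        have "runs r ?body u (50 * r ^ 5 + 1) (I (Suc c))"
        proof (rule runs_Seq)
          show "runs r encode_row u (50 * r ^ 5) (\<lambda>s'.
              s' ''out'' = (u ''out'')(int c := int (code b l (depth b) (row b x c) 0)) \<and>
                  (\<forall>j\<ge>b. s' ''a'' (int j) = 0))"
            using u(1,3) ueq s x c unfolding I_def by (intro runs_encode_row) auto
        next
          fix w
          assume w: "bounded r w" "\<And>x. x \<notin> modified encode_row \<Longrightarrow> w x = u x"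
            "w ''out'' = (u ''out'')(int c := int (code b l (depth b) (row b x c) 0)) \<and>
                (\<forall>j\<ge>b. w ''a'' (int j) = 0)"
          have "w ''i'' = u ''i''" using w(2) mods by simp
          then show "runs r (''i'' ::= Add (var ''i'') (Num 1)) w 1 (I (Suc c))"
            using bits_bounds w(1,3) u(3) c c1 by (intro runs_assign) (auto simp: I_def psi_def less_Suc_eq)
        qed
        then show "c < r \<and> runs r ?body u (50 * r ^ 5 + 1) (I (Suc c))" using c bits_bounds by simp
      next
        fix c u
        assume u: "bounded r u" "\<And>x. x \<notin> modified ?body \<Longrightarrow> u x = ?s x" "I c u" "\<not> bval (Less (var ''i'')
            (var ''l'')) u"
        have "u ''l'' = s ''l''" using u(2) mods by simp
        then have "c = l" using u(3,4) s by (simp add: I_def)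
        with u(3) show "I l u" by simp
      qed (use bits_bounds bs in auto)
    next
      fix u
      assume u: "bounded r u" "\<And>x. x \<notin> modified ?loop \<Longrightarrow> u x = ?s x" "I l u"
      have "u ''l'' = s ''l''" using u(2) mods by simp
      then show "runs r (''len'' ::= var ''l'') u 1 ?R"
        using u bits_bounds lr s by (intro runs_assign) (auto simp: I_def)
    qed
  qed (use bits_bounds s in auto)
  then show ?thesis
  proof (rule runs_mono)
    have r: "1 \<le> r" by (rule bits_bounds)
    have "r ^ 1 \<le> r ^ 6" "r ^ 0 \<le> r ^ 6" using r by (intro power_increasing; simp)+
    moreover have "1 + ((r * ((50 * r ^ 5 + 1) + 1) + 1) + 1) = 50 * r ^ 6 + 2 * r + 3"
      by (simp add: algebra_simps power_numeral_reduce)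
    ultimately show "1 + ((r * ((50 * r ^ 5 + 1) + 1) + 1) + 1) \<le> 60 * r ^ 6"
      by simp
  qed
qed

section \<open>Verification of the enumerator\<close>

text \<open>Beyond the new bound the flags of both levels are therefore false, so rewriting the
  cells below it completes the new table.\<close>

lemma dot_bound_mono:
  "dot_bound b l i \<le> dot_bound b l (Suc i)"
proof -
  have "dot_bound b l i \<le> (\<Prod>k<1. modulus (dot_bound b l i) k)" using le_modulus by simp
  also have "\<dots> \<le> code_bound b l (Suc i)"
    unfolding code_bound_Suc by (rule prod_modulus_le) (simp add: Suc_le_eq)
  also have "1 * code_bound b l (Suc i) * 1 \<le> l * code_bound b l (Suc i) * code_bound b l (Suc i)"
    using l code_bound_pos[of b l "Suc i"] by (intro mult_le_mono) (auto simp: Suc_le_eq)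
  then have "code_bound b l (Suc i) \<le> dot_bound b l (Suc i)"
    by (simp add: dot_bound_def power2_eq_square mult.assoc)
  finally show ?thesis .
qed

lemma runs_enumerate_level:
  assumes s: "bounded r s" "s ''b'' 0 = int b" "s ''l'' 0 = int l" "at_level i s" "\<And>n. s ''a'' n = 0"
      "\<And>w. s ''Z'' (int w) = of_bool (zero_code b l i w)"
    and i: "i < depth b" and W: "dot_bound b l (Suc i) \<le> W"
  shows "runs r enumerate_level s (70 * W * r ^ 3)
    (\<lambda>s'. at_level (Suc i) s' \<and> (\<forall>w. s' ''Z'' (int w) = of_bool (zero_code b l (Suc i) w)))"
proof -
  define D where "D = dot_bound b l (Suc i)"
  let ?R = "\<lambda>s'. at_level (Suc i) s' \<and> (\<forall>w. s' ''Z'' (int w) = of_bool (zero_code b l (Suc i) w))"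
  have Dr: "D \<le> 2 ^ r" using dot_bound_bits(1)[of "Suc i"] i by (simp add: D_def)
  have l0: "0 < l" using l by simp
  let ?body = "''v'' ::= Sub (var ''v'') (Num 1) ;; sweep ;; Assign ''Z'' (var ''v'') (var ''f'')"
  let ?loop = "While (Less (Num 0) (var ''v'')) ?body"
  let ?suffix = "''M'' ::= var ''Q'' ;; ''t'' ::= Mul (var ''t'') (var ''g'')"
  let ?v = "Mul (var ''l'') (Mul (var ''Q'') (var ''Q''))"
  \<comment> \<open>The top \<open>n\<close> of the \<open>D\<close> cells, and all those above,
    hold flags of the new level; the cells below \<open>D - n\<close> still hold the old
    ones.\<close>
  define I where "I n s' \<longleftrightarrow> n \<le> D \<and> s' ''v'' 0 = int (D - n) \<and> s' ''Q'' 0 = int (code_bound b l (Suc i)) \<and>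
    (\<forall>w. s' ''Z'' (int w) = of_bool (zero_code b l (if D - n \<le> w then Suc i else i) w))"
      for n and s' :: state
  have "runs r enumerate_level s
      (1 + (6 * r + (24 * r ^ 3 + (1 + ((W * ((1 + (24 * r ^ 3 + 1)) + 1) + 1) + 2))))) ?R"
    unfolding enumerate_level_def
  proof (rule runs_level_prefix[OF s(1-4) i])
    fix u
    assume u: "bounded r u" "\<And>x. x \<notin> {''K'', ''g'', ''u''} \<Longrightarrow> u x = s x"
      "u ''g'' 0 = int (groups b i)" "u ''K'' 0 = int (dot_bound b l i)"
    show "runs r (sweep ;; ''v'' ::= ?v ;; ?loop ;; ?suffix) u
        (24 * r ^ 3 + (1 + ((W * ((1 + (24 * r ^ 3 + 1)) + 1) + 1) + 2))) ?R"
    proof (rule runs_Seq)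
      \<comment> \<open>The enumerator never writes to \<open>''a''\<close>, so all residues are
        0.\<close>
      show "runs r sweep u (24 * r ^ 3) (\<lambda>s'.
          s' ''X'' 0 = int (crt (groups b i) (modulus (dot_bound b l i)) (\<lambda>_. 0)) \<and>
          s' ''Q'' 0 = int (code_bound b l (Suc i)) \<and>
          s' ''f'' 0 = of_bool (\<forall>k<groups b i. u ''Z'' (u ''v'' 0 mod int (modulus (dot_bound b l i) k))
              \<noteq> 0))"
        by (rule runs_level_sweep) (use u i s in auto)
    next
      fix x
      assume x: "bounded r x" "\<And>y. y \<notin> modified sweep \<Longrightarrow> x y = u y"
        "x ''X'' 0 = int (crt (groups b i) (modulus (dot_bound b l i)) (\<lambda>_. 0)) \<and>
          x ''Q'' 0 = int (code_bound b l (Suc i)) \<and>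
          x ''f'' 0 = of_bool (\<forall>k<groups b i. u ''Z'' (u ''v'' 0 mod int (modulus (dot_bound b l i) k))
              \<noteq> 0)"
      have xeq: "x ''l'' = s ''l''" "x ''g'' = u ''g''" "x ''K'' = u ''K''" "x ''a'' = s ''a''"
          "x ''Z'' = s ''Z''"
        "x ''t'' = s ''t''"
        using x(2) u(2) by (simp_all add: modified_sweep)
      have v: "aval ?v x = int D" using xeq s x(3) by (simp add: D_def dot_bound_def power2_eq_square)
      let ?x = "upd x ''v'' (aval (Num 0) x) (aval ?v x)"
      show "runs r (''v'' ::= ?v ;; ?loop ;; ?suffix) x
          (1 + ((W * ((1 + (24 * r ^ 3 + 1)) + 1) + 1) + 2)) ?R"
      proof (rule runs_assign_Seq)
        show "\<bar>aval ?v x\<bar> \<le> 2 ^ r" unfolding v using int_le_two_power'[OF Dr] by simp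
        assume bx: "bounded r ?x"
        show "runs r (?loop ;; ?suffix) ?x ((W * ((1 + (24 * r ^ 3 + 1)) + 1) + 1) + 2) ?R"
        proof (rule runs_Seq)
          show "runs r ?loop ?x (W * ((1 + (24 * r ^ 3 + 1)) + 1) + 1) (I D)"
          proof (rule runs_While[where I = I])
            have "zero_code b l i w = zero_code b l (if D \<le> w then Suc i else i) w" for w
              using zero_code_less[OF l0, of b i w] zero_code_less[OF l0, of b "Suc i"
                  w] dot_bound_mono[of i]
              by (auto simp: D_def simp del: zero_code.simps)
            then show "I 0 ?x" using s(6) v x(3) xeq
                by (simp add: I_def del: zero_code.simps aval.simps(2,5))
          next
            fix n y
            assume y: "bounded r y" "\<And>z. z \<notin> modified ?body \<Longrightarrow> y z = ?x z" "I n y"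
              "bval (Less (Num 0) (var ''v'')) y"
            define w where "w = D - Suc n"
            have n: "n < D" using y(3,4) by (simp add: I_def)
            have w: "D - n = Suc w" "D - Suc n = w" "w < D" using n by (auto simp: w_def)
            have yeq: "y ''g'' = u ''g''" "y ''K'' = u ''K''" "y ''a'' = s ''a''"
              using y(2) xeq by (simp_all add: modified_sweep)
            have wr: "int w \<le> 2 ^ r" using Dr w(3) by (intro int_le_two_power') simp
            let ?y = "upd y ''v'' (aval (Num 0) y) (aval (Sub (var ''v'') (Num 1)) y)"
            have "runs r ?body y (1 + (24 * r ^ 3 + 1)) (I (Suc n))"
            proof (rule runs_assign_Seq)
              assume by': "bounded r ?y"
              show "runs r (sweep ;; Assign ''Z'' (var ''v'') (var ''f'')) ?y (24 * r ^ 3 + 1) (I (Suc n))"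
              proof (rule runs_Seq)
                show "runs r sweep ?y (24 * r ^ 3) (\<lambda>s'.
                    s' ''X'' 0 = int (crt (groups b i) (modulus (dot_bound b l i)) (\<lambda>_. 0)) \<and>
                    s' ''Q'' 0 = int (code_bound b l (Suc i)) \<and>
                    s' ''f'' 0 = of_bool (\<forall>k<groups b i. ?y ''Z'' (?y ''v'' 0 mod int (modulus
                        (dot_bound b l i) k)) \<noteq> 0))"
                  by (rule runs_level_sweep) (use by' u i s yeq in auto)
              next
                fix z
                assume z: "bounded r z" "\<And>x. x \<notin> modified sweep \<Longrightarrow> z x = ?y x"
                  "z ''X'' 0 = int (crt (groups b i) (modulus (dot_bound b l i)) (\<lambda>_. 0)) \<and>
                    z ''Q'' 0 = int (code_bound b l (Suc i)) \<and>
                    z ''f'' 0 = of_bool (\<forall>k<groups b i. ?y ''Z'' (?y ''v'' 0 mod int (modulus (dot_bound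
                        b l i) k)) \<noteq> 0)"
                have yv: "?y ''v'' 0 = int w" using y(3) w by (simp add: I_def)
                have zeq: "z ''v'' 0 = int w" "z ''Z'' = y ''Z''"
                  using z(2)[of "''v''"] z(2)[of "''Z''"] yv by (simp_all add: modified_sweep)
                have "?y ''Z'' (?y ''v'' 0 mod int m) = of_bool (zero_code b l i (w mod m))" for m
                proof -
                  \<comment> \<open>A modulus above \<open>w\<close> makes the sweep read cell
                    \<open>w\<close> itself, which is overwritten only afterwards.\<close>
                  have "w mod m < Suc w" by (simp add: less_Suc_eq_le)
                  moreover have "y ''Z'' (int (w mod m)) = of_bool (zero_code b l (if D - n \<le>
                      w mod m then Suc i else i) (w mod m))"
                    using y(3) unfolding I_def by blast
                  ultimately show ?thesis unfolding yv using w(1) by (simp add: of_nat_mod)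
                qed
                then have f: "z ''f'' 0 = of_bool (zero_code b l (Suc i) w)"
                  using z(3) w(3) by (simp add: D_def)
                have Zy: "y ''Z'' (int m) = of_bool (zero_code b l (if Suc w \<le> m then Suc i else i) m)"
                    for m
                  using y(3) w(1) unfolding I_def by simp
                have "of_bool (zero_code b l (Suc i) w) \<le> (2::int) ^ r" by (simp add: of_bool_def)
                then show "runs r (Assign ''Z'' (var ''v'') (var ''f'')) z 1 (I (Suc n))"
                  using bits_bounds z zeq f w Zy n
                  by (intro runs_assign) (auto simp: I_def not_less_eq_eq le_Suc_eq simp del:
                      zero_code.simps)
              qed
            qed (use bits_bounds y w wr in \<open>auto simp: I_def\<close>)
            then show "n < W \<and> runs r ?body y (1 + (24 * r ^ 3 + 1)) (I (Suc n))" using n W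
                by (simp add: D_def)
          next
            fix n y
            assume y: "bounded r y" "\<And>z. z \<notin> modified ?body \<Longrightarrow> y z = ?x z" "I n y"
              "\<not> bval (Less (Num 0) (var ''v'')) y"
            then have "n = D" by (simp add: I_def)
            with y(3) show "I D y" by simp
          qed (use bits_bounds bx in auto)
        next
          fix y
          assume y: "bounded r y" "\<And>z. z \<notin> modified ?loop \<Longrightarrow> y z = ?x z" "I D y"
          have yeq: "y ''g'' = u ''g''" "y ''t'' = s ''t''" using y(2) xeq by (simp_all add: modified_sweep)
          show "runs r ?suffix y 2 ?R"
            using y i u yeq s(4)
            by (intro runs_level_suffix[of _ i]) (auto simp: I_def at_level_def simp del: zero_code.simps)
        qed
      qed (use bits_bounds x in auto)
    qed
  qed
  then show ?thesis
  proof (rule runs_mono)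
    have r: "1 \<le> r" by (rule bits_bounds)
    have W1: "1 \<le> W" using W dot_bound_pos[OF l0, of b "Suc i"] by simp
    have "r ^ 1 \<le> r ^ 3" "r ^ 0 \<le> r ^ 3" using r by (intro power_increasing; simp)+
    then have "1 * r \<le> W * r ^ 3" "1 * 1 \<le> W * r ^ 3" "1 * r ^ 3 \<le> W * r ^ 3" "W * 1 \<le> W * r ^ 3"
      using W1 by (intro mult_le_mono; simp)+
    moreover have "1 + (6 * r + (24 * r ^ 3 + (1 + ((W * ((1 + (24 * r ^ 3 + 1)) + 1) + 1) + 2)))) =
        24 * (W * r ^ 3) + 3 * W + 24 * r ^ 3 + 6 * r + 5"
      by (simp add: algebra_simps)
    ultimately show "1 + (6 * r + (24 * r ^ 3 + (1 + ((W * ((1 + (24 * r ^ 3 + 1)) + 1) + 1) + 2)))) \<le>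
        70 * W * r ^ 3"
      unfolding mult.assoc by linarith
  qed
qed

lemma runs_collect:
  assumes s: "bounded r s" "s ''l'' 0 = int l" "s ''len'' 0 = 0" "at_level (depth b) s"
      "\<And>w. s ''Z'' (int w) = of_bool (P w)"
    and W: "dot_bound b l (depth b) \<le> W"
  shows "runs r collect s (6 * W + 2) (\<lambda>s'.
    let vs = filter P [0..<dot_bound b l (depth b)]
    in s' ''len'' 0 = int (length vs) \<and> (\<forall>i<length vs. s' ''out'' (int i) = int (vs ! i)))"
proof -
  define D where "D = dot_bound b l (depth b)"
  have Dr: "D \<le> 2 ^ r" using dot_bound_bits(1)[of "depth b"] by (simp add: D_def)
  define vs where "vs n = filter P [0..<n]" for n
  have vs_Suc: "vs (Suc n) = (if P n then vs n @ [n] else vs n)" for n by (simp add: vs_def)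
  have vs_len: "length (vs n) \<le> n" for n
    using length_filter_le[of P "[0..<n]"] by (simp add: vs_def)
  let ?R = "\<lambda>n s'. s' ''len'' 0 = int (length (vs n)) \<and> (\<forall>i<length (vs n). s' ''out'' (int i)
      = int (vs n ! i))"
  define I where "I n s' \<longleftrightarrow> n \<le> D \<and> s' ''v'' 0 = int n \<and> ?R n s'" for n and s' :: state
  let ?test = "Less (var ''v'') (Mul (var ''l'') (Mul (var ''M'') (var ''M'')))"
  let ?app = "Assign ''out'' (var ''len'') (var ''v'') ;; ''len'' ::= Add (var ''len'') (Num 1)"
  let ?if = "If (Equal (Cell ''Z'' (var ''v'')) (Num 0)) Skip (?app)"
  let ?body = "?if ;; ''v'' ::= Add (var ''v'') (Num 1)"
  have test: "bval ?test u \<longleftrightarrow> n < D" if "u ''l'' = s ''l''" "u ''M'' = s ''M''" "I n u" for n u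
  proof -
    have "bval ?test u \<longleftrightarrow> int n < int D"
      using that s by (simp add: I_def D_def at_level_def dot_bound_def power2_eq_square)
    then show ?thesis by simp
  qed
  have "runs r collect s (1 + (W * (((1 + 1 + 1) + 1) + 1) + 1)) (?R D)"
    unfolding collect_def
  proof (rule runs_assign_Seq)
    let ?s = "upd s ''v'' (aval (Num 0) s) (aval (Num 0) s)"
    assume bs: "bounded r ?s"
    show "runs r (While ?test ?body) ?s (W * (((1 + 1 + 1) + 1) + 1) + 1) (?R D)"
    proof (rule runs_While[where I = I])
      show "I 0 ?s" using s by (simp add: I_def vs_def)
    next
      fix n u
      assume u: "bounded r u" "\<And>x. x \<notin> modified ?body \<Longrightarrow> u x = ?s x" "I n u" "bval ?test u"
      have ueq: "u ''l'' = s ''l''" "u ''M'' = s ''M''" "u ''Z'' = s ''Z''" using u(2) by simp_all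
      have n: "n < D" using test[OF ueq(1,2) u(3)] u(4) by simp
      have "int (Suc n) \<le> 2 ^ r" "int n \<le> 2 ^ r" using n Dr by (intro int_le_two_power'; simp)+
      moreover have "int (Suc (length (vs n))) \<le> 2 ^ r" using n Dr vs_len[of n]
          by (intro int_le_two_power') simp
      ultimately have bd: "1 + int n \<le> 2 ^ r" "int n \<le> 2 ^ r" "1 + int (length (vs n)) \<le> 2 ^ r" by simp_all
      have Z: "u ''Z'' (int n) = of_bool (P n)" using ueq s(5) by simp
      have "runs r ?body u ((1 + 1 + 1) + 1) (I (Suc n))"
      proof (rule runs_Seq)
        show "runs r ?if u (1 + 1 + 1) (\<lambda>s'. s' ''v'' 0 = int n \<and> ?R (Suc n) s')"
        proof (rule runs_If)
          assume "bval (Equal (Cell ''Z'' (var ''v'')) (Num 0)) u"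
          then have "\<not> P n" using Z u(3) by (simp add: I_def)
          then have "runs r Skip u 1 (\<lambda>s'. s' ''v'' 0 = int n \<and> ?R (Suc n) s')"
            using u bits_bounds by (intro runs_Skip) (auto simp: I_def vs_Suc)
          then show "runs r Skip u (1 + 1) (\<lambda>s'. s' ''v'' 0 = int n \<and> ?R (Suc n) s')"
              by (rule runs_mono) auto
        next
          assume "\<not> bval (Equal (Cell ''Z'' (var ''v'')) (Num 0)) u"
          then have "P n" using Z u(3) by (simp add: I_def)
          then show "runs r (?app) u (1 + 1) (\<lambda>s'. s' ''v'' 0 = int n \<and> ?R (Suc n) s')"
            using u bits_bounds bd by (intro runs_assign_Seq runs_assign) (auto simp: I_def vs_Suc
                nth_append less_Suc_eq)
        qed (use u bits_bounds in auto)
      next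
        fix w
        assume w: "bounded r w" "w ''v'' 0 = int n \<and> ?R (Suc n) w"
        then show "runs r (''v'' ::= Add (var ''v'') (Num 1)) w 1 (I (Suc n))"
          using n bits_bounds bd by (intro runs_assign) (auto simp: I_def)
      qed
      then show "n < W \<and> runs r ?body u ((1 + 1 + 1) + 1) (I (Suc n))" using n W by (simp add: D_def)
    next
      fix n u
      assume u: "bounded r u" "\<And>x. x \<notin> modified ?body \<Longrightarrow> u x = ?s x" "I n u" "\<not> bval ?test u"
      have "u ''l'' = s ''l''" "u ''M'' = s ''M''" using u(2) by simp_all
      then have "n = D" using test[of u n] u(3,4) by (simp add: I_def)
      with u(3) show "?R D u" by (simp add: I_def)
    qed (use bits_bounds bs in auto)
  qed (use bits_bounds s in auto)
  then show ?thesis by (rule runs_mono) (auto simp: vs_def D_def Let_def)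
qed

text \<open>Setting cell 0 of \<open>''Z''\<close> gives the table of level 0. A factor
  \<open>r\<close> accounts for the levels, and \<open>W\<close> bounds the length of every
  table.\<close>

lemma runs_enumerator:
  assumes s: "bounded r s" "s ''b'' 0 = int b" "s ''l'' 0 = int l" "s ''len'' 0 = 0"
      "\<And>n. s ''a'' n = 0" "\<And>n. s ''Z'' n = 0"
    and W: "\<And>i. i \<le> depth b \<Longrightarrow> dot_bound b l i \<le> W"
  shows "runs r enumerator s (90 * W * r ^ 4) (\<lambda>s'.
    let vs = filter (zero_code b l (depth b)) [0..<dot_bound b l (depth b)]
    in s' ''len'' 0 = int (length vs) \<and> (\<forall>i<length vs. s' ''out'' (int i) = int (vs ! i)))" (is
        "runs _ _ _ _ ?R")
proof -
  define I where "I i s' \<longleftrightarrow> i \<le> depth b \<and> at_level i s' \<and> (\<forall>w. s' ''Z'' (int w) = of_bool (zero_code b l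
      i w))"
    for i and s' :: state
  let ?loop = "While (Less (var ''t'') (var ''b'')) enumerate_level"
  have two: "(2::int) \<le> 2 ^ r" using int_le_two_power[of 2 r] bits_bounds(2) b by simp
  have mods: "x \<notin> modified enumerate_level" if "x \<in> {''b'', ''l'', ''a'', ''len''}" for x
    using that by (auto simp: enumerate_level_def modified_choose_group modified_sweep)
  let ?u1 = "upd s ''Z'' (aval (Num 0) s) (aval (Num 1) s)"
  let ?u2 = "upd ?u1 ''t'' (aval (Num 0) ?u1) (aval (Num 1) ?u1)"
  let ?u = "upd ?u2 ''M'' (aval (Num 0) ?u2) (aval (Num 2) ?u2)"
  have "runs r enumerator s (1 + (1 + (1 + ((r * (70 * W * r ^ 3 + 1) + 1) + (6 * W + 2))))) ?R"
    unfolding enumerator_def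
  proof (intro runs_assign_Seq)
    assume bu: "bounded r ?u"
    show "runs r (?loop ;; collect) ?u ((r * (70 * W * r ^ 3 + 1) + 1) + (6 * W + 2)) ?R"
    proof (rule runs_Seq)
      show "runs r ?loop ?u (r * (70 * W * r ^ 3 + 1) + 1) (I (depth b))"
      proof (rule runs_While[where I = I])
        show "I 0 ?u" using s by (simp add: I_def at_level_0)
      next
        fix i w
        assume w: "bounded r w" "\<And>x. x \<notin> modified enumerate_level \<Longrightarrow> w x = ?u x" "I i w"
          "bval (Less (var ''t'') (var ''b'')) w"
        have weq: "w ''b'' = s ''b''" "w ''l'' = s ''l''" "w ''a'' = s ''a''" using w(2) mods by simp_all
        then have i: "i < depth b" using w(3,4) s at_level_test[of i w] by (simp add: I_def)
        have "runs r enumerate_level w (70 * W * r ^ 3)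
            (\<lambda>s'. at_level (Suc i) s' \<and> (\<forall>w. s' ''Z'' (int w) = of_bool (zero_code b l (Suc i) w)))"
          using w i weq s W[of "Suc i"] unfolding I_def by (intro runs_enumerate_level) auto
        then have "runs r enumerate_level w (70 * W * r ^ 3) (I (Suc i))"
          using i by (elim runs_mono) (auto simp: I_def simp del: zero_code.simps)
        then show "i < r \<and> runs r enumerate_level w (70 * W * r ^ 3) (I (Suc i))"
            using i depth_less_bits by simp
      next
        fix i w
        assume w: "bounded r w" "\<And>x. x \<notin> modified enumerate_level \<Longrightarrow> w x = ?u x" "I i w"
          "\<not> bval (Less (var ''t'') (var ''b'')) w"
        have "w ''b'' = s ''b''" using w(2) mods by simp
        then have "i = depth b" using w(3,4) s at_level_test[of i w] by (simp add: I_def)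
        with w(3) show "I (depth b) w" by simp
      qed (use bits_bounds bu in auto)
    next
      fix w
      assume w: "bounded r w" "\<And>x. x \<notin> modified ?loop \<Longrightarrow> w x = ?u x" "I (depth b) w"
      have "w ''l'' = s ''l''" "w ''len'' = s ''len''" using w(2) mods by simp_all
      then show "runs r collect w (6 * W + 2) ?R"
        using w s W[of "depth b"] unfolding I_def by (intro runs_collect) auto
    qed
  qed (use bits_bounds two s in auto)
  then show ?thesis
  proof (rule runs_mono)
    have r: "1 \<le> r" by (rule bits_bounds)
    have W1: "1 \<le> W" using W[of 0] dot_bound_pos[of l b 0] l by simp
    have "r ^ 1 \<le> r ^ 4" "r ^ 0 \<le> r ^ 4" using r by (intro power_increasing; simp)+
    then have "1 * r \<le> W * r ^ 4" "1 * 1 \<le> W * r ^ 4" "W * 1 \<le> W * r ^ 4"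
      using W1 by (intro mult_le_mono; simp)+
    moreover have "1 + (1 + (1 + ((r * (70 * W * r ^ 3 + 1) + 1) + (6 * W + 2)))) =
        70 * (W * r ^ 4) + r + 6 * W + 6"
      by (simp add: algebra_simps power_numeral_reduce)
    ultimately show "1 + (1 + (1 + ((r * (70 * W * r ^ 3 + 1) + 1) + (6 * W + 2)))) \<le> 90 * W * r ^ 4"
      unfolding mult.assoc by linarith
  qed
qed

end

section \<open>Explicit running times and conclusion\<close>

lemma outputs_withinI:
  assumes "runs r c (input_state inp) n
      (\<lambda>s. s ''len'' 0 = int (length res) \<and> (\<forall>i<length res. s ''out'' (int i) = res ! i))"
    and "n * (60 * r)\<^sup>2 \<le> T"
  shows "outputs_within c inp res T"
  using assms unfolding runs_def outputs_within_def by (meson order_trans)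

lemma bounded_input_state:
  assumes "\<And>x v. v \<in> set (inp x) \<Longrightarrow> \<bar>v\<bar> \<le> 2 ^ r"
  shows "bounded r (input_state inp)"
  using assms unfolding bounded_def input_state_def by (auto intro!: assms nth_mem simp: nat_less_iff)

text \<open>The time bounds are to be polynomials in the product \<open>b * l\<close> alone.\<close>

lemma bits_le: "0 < l \<Longrightarrow> bits b l \<le> 40 * (b * l)\<^sup>2"
proof -
  assume "0 < l"
  then have "40 * b\<^sup>2 * (l * 1) \<le> 40 * b\<^sup>2 * (l * l)" by (intro mult_le_mono) auto
  then show ?thesis by (simp add: bits_def power2_eq_square mult_ac)
qed

text \<open>Here 60 r^6 steps of cost (60 r)^2 make 216000 r^8, and r \<le> 40 (b l)^2.\<close>

lemma encoder_outputs:
  assumes b: "3 \<le> b" and l: "16 \<le> l" and x: "x \<in> vecs {0, 1} (b * l)"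
  shows "outputs_within encoder ((\<lambda>_. [])(''b'' := [int b], ''l'' := [int l], ''x'' := x))
    (psi b l x) (216000 * 40 ^ 8 * (b * l) ^ 16)"
proof (rule outputs_withinI)
  define r where "r = bits b l"
  note bb = bits_bounds[OF b l r_def]
  let ?inp = "(\<lambda>_. [])(''b'' := [int b], ''l'' := [int l], ''x'' := x)"
  have "\<bar>v\<bar> \<le> 2 ^ r" if "v \<in> set (?inp y)" for y v
  proof -
    have "v = int b \<or> v = int l \<or> v = 0 \<or> v = 1"
      using that x by (auto simp: vecs_def split: if_splits)
    then show ?thesis
      using bb int_le_two_power[of b r] int_le_two_power[of l r] by auto
  qed
  then have "bounded r (input_state ?inp)" by (rule bounded_input_state)
  then have "runs r encoder (input_state ?inp) (60 * r ^ 6)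
      (\<lambda>s'. s' ''len'' 0 = int l \<and> (\<forall>c<l. s' ''out'' (int c) = psi b l x ! c))"
    using x by (intro runs_encoder[OF b l r_def]) (auto simp: input_state_def vecs_def simp flip:
        of_nat_mult)
  then show "runs (bits b l) encoder (input_state ?inp) (60 * bits b l ^ 6)
      (\<lambda>s. s ''len'' 0 = int (length (psi b l x)) \<and> (\<forall>i<length (psi b l x). s ''out'' (int i)
        = psi b l x ! i))"
    by (simp add: psi_def r_def)
  have "60 * r ^ 6 * (60 * r)\<^sup>2 = 216000 * r ^ 8"
    by (simp add: power_mult_distrib flip: power_add)
  also have "\<dots> \<le> 216000 * (40 * (b * l)\<^sup>2) ^ 8"
    unfolding r_def using l by (intro mult_left_mono power_mono bits_le) auto
  also have "\<dots> = 216000 * 40 ^ 8 * (b * l) ^ 16"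
    by (simp only: power_mult_distrib mult.assoc flip: power_mult) simp
  finally show "60 * bits b l ^ 6 * (60 * bits b l)\<^sup>2 \<le> 216000 * 40 ^ 8 * (b * l) ^ 16"
    by (simp only: r_def)
qed

text \<open>With e the exponent of the code bound, inner products are at most l * (l ^ e)^2 \<le> l
  ^ (3 e). This is the table length \<open>W\<close>, and 90 W r^4 steps of cost (60 r)^2 make
  324000 W r^6.\<close>

lemma enumerator_outputs:
  assumes b: "3 \<le> b" and l: "16 \<le> l"
  shows "\<exists>vs. distinct vs \<and> set vs = zero_dots b l \<and>
    outputs_within enumerator ((\<lambda>_. [])(''b'' := [int b], ''l'' := [int l])) vs
      (324000 * 40 ^ 6 * (l ^ (3 * (6 ^ log_star (real b) * b)) * (b * l) ^ 12))"
proof (intro exI conjI)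
  define r where "r = bits b l"
  define W where "W = l ^ (3 * (6 ^ log_star (real b) * b))"
  note bb = bits_bounds[OF b l r_def]
  let ?inp = "(\<lambda>_. [])(''b'' := [int b], ''l'' := [int l])"
  let ?ns = "filter (zero_code b l (depth b)) [0..<dot_bound b l (depth b)]"
  show "distinct (map int ?ns)" by (simp add: distinct_map)
  show "set (map int ?ns) = zero_dots b l"
    using zero_code_less[of l b "depth b"] l by (auto simp: zero_dots_def)
  have W: "dot_bound b l i \<le> W" if "i \<le> depth b" for i
  proof -
    let ?e = "6 ^ log_star (real b) * b"
    have "dot_bound b l i \<le> l * (l ^ ?e)\<^sup>2"
      unfolding dot_bound_def using that b l by (intro mult_left_mono power_mono code_bound_le_log_star)
          auto
    also have "\<dots> = l ^ (1 + ?e * 2)" by (simp flip: power_mult)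
    also have "\<dots> \<le> W"
      unfolding W_def
    proof (rule power_increasing)
      have "1 \<le> ?e" using b by (simp add: Suc_le_eq)
      then show "1 + ?e * 2 \<le> 3 * ?e" by linarith
    qed (use l in simp)
    finally show ?thesis .
  qed
  show "outputs_within enumerator ?inp (map int ?ns)
      (324000 * 40 ^ 6 * (l ^ (3 * (6 ^ log_star (real b) * b)) * (b * l) ^ 12))"
  proof (rule outputs_withinI)
    have "\<bar>v\<bar> \<le> 2 ^ r" if "v \<in> set (?inp y)" for y v
      using that bb int_le_two_power[of b r] int_le_two_power[of l r] by (auto split: if_splits)
    then have "bounded r (input_state ?inp)" by (rule bounded_input_state)
    then have "runs r enumerator (input_state ?inp) (90 * W * r ^ 4) (\<lambda>s'.
        let vs = ?ns in s' ''len'' 0 = int (length vs) \<and> (\<forall>i<length vs. s' ''out'' (int i) = int (vs ! i)))"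
      using W by (intro runs_enumerator[OF b l r_def]) (auto simp: input_state_def)
    then show "runs (bits b l) enumerator (input_state ?inp) (90 * W * bits b l ^ 4)
      (\<lambda>s. s ''len'' 0 = int (length (map int ?ns)) \<and>
        (\<forall>i<length (map int ?ns). s ''out'' (int i) = map int ?ns ! i))"
      by (simp add: r_def Let_def)
    have "90 * W * r ^ 4 * (60 * r)\<^sup>2 = 324000 * W * r ^ 6"
      by (simp add: power_mult_distrib flip: power_add)
    also have "\<dots> \<le> 324000 * W * (40 * (b * l)\<^sup>2) ^ 6"
      unfolding r_def using l by (intro mult_left_mono power_mono bits_le) auto
    also have "\<dots> = 324000 * W * (40 ^ 6 * (b * l) ^ 12)"
      by (simp only: power_mult_distrib flip: power_mult) simp
    finally show "90 * W * bits b l ^ 4 * (60 * bits b l)\<^sup>2 \<le>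
        324000 * 40 ^ 6 * (l ^ (3 * (6 ^ log_star (real b) * b)) * (b * l) ^ 12)"
      by (simp only: r_def W_def mult_ac)
  qed
qed

theorem theorem4p1:
  shows "\<exists>(N::nat) (\<psi> :: nat \<Rightarrow> nat \<Rightarrow> int list \<Rightarrow> int list) (V :: nat \<Rightarrow> nat \<Rightarrow> int set).
    (\<forall>b\<ge>N. \<forall>l\<ge>N.
        \<psi> b l \<in> vecs {0, 1} (b * l) \<rightarrow> vecs UNIV l \<and>
        (\<forall>x\<in>vecs {0, 1} (b * l). \<forall>y\<in>vecs {0, 1} (b * l).
           dot x y = 0 \<longleftrightarrow> dot (\<psi> b l x) (\<psi> b l y) \<in> V b l) \<and>
        (\<forall>x\<in>vecs {0, 1} (b * l). \<forall>i<l.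
           0 \<le> \<psi> b l x ! i \<and> \<psi> b l x ! i < int l ^ (6 ^ log_star (real b) * b))) \<and>
    (\<exists>(P :: com) (p :: nat poly). \<forall>b\<ge>N. \<forall>l\<ge>N. \<forall>x\<in>vecs {0, 1} (b * l).
        outputs_within P ((\<lambda>_. [])(''b'' := [int b], ''l'' := [int l], ''x'' := x))
          (\<psi> b l x) (poly p (b * l))) \<and>
    (\<exists>(Q :: com) (q :: nat poly) (c :: nat) (C :: nat). \<forall>b\<ge>N. \<forall>l\<ge>N.
        \<exists>vs. distinct vs \<and> set vs = V b l \<and>
          outputs_within Q ((\<lambda>_. [])(''b'' := [int b], ''l'' := [int l]))
            vs (C * (l ^ (c * (6 ^ log_star (real b) * b)) * poly q (b * l))))"
proof (intro exI[of _ 16] exI[of _ psi] exI[of _ zero_dots] conjI allI impI ballI)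
  fix b l :: nat
  \<comment> \<open>The bound on \<open>l\<close> is that of \<open>nth_prime_le_power\<close>; for
    \<open>b\<close> it implies \<open>2 < b\<close>, which ensures
    \<open>log_star b \<ge> 2\<close>.\<close>
  assume N: "16 \<le> b" "16 \<le> l"
  show "psi b l \<in> vecs {0, 1} (b * l) \<rightarrow> vecs UNIV l" by (auto simp: psi_def vecs_def)
  fix x assume x: "x \<in> vecs {0, 1} (b * l)"
  show "dot x y = 0 \<longleftrightarrow> dot (psi b l x) (psi b l y) \<in> zero_dots b l"
    if "y \<in> vecs {0, 1} (b * l)" for y
    using x that N by (intro psi_dot) auto
  fix i assume "i < l"
  then show "0 \<le> psi b l x ! i" "psi b l x ! i < int l ^ (6 ^ log_star (real b) * b)"
    using x N by (simp add: psi_def) (use x N \<open>i < l\<close> in \<open>auto intro: psi_nth_less\<close>)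
next
  show "\<exists>(P :: com) (p :: nat poly). \<forall>b\<ge>16. \<forall>l\<ge>16. \<forall>x\<in>vecs {0, 1} (b * l).
      outputs_within P ((\<lambda>_. [])(''b'' := [int b], ''l'' := [int l], ''x'' := x))
        (psi b l x) (poly p (b * l))"
    by (intro exI[of _ encoder] exI[of _ "monom (216000 * 40 ^ 8) 16"])
      (auto simp only: poly_monom intro!: encoder_outputs)
  show "\<exists>(Q :: com) (q :: nat poly) (c :: nat) (C :: nat). \<forall>b\<ge>16. \<forall>l\<ge>16.
      \<exists>vs. distinct vs \<and> set vs = zero_dots b l \<and>
        outputs_within Q ((\<lambda>_. [])(''b'' := [int b], ''l'' := [int l]))
          vs (C * (l ^ (c * (6 ^ log_star (real b) * b)) * poly q (b * l)))"
    by (intro exI[of _ enumerator] exI[of _ "monom 1 12"] exI[of _ 3] exI[of _ "324000 * 40 ^ 6"])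
      (auto simp only: poly_monom mult_1 intro!: enumerator_outputs)
qed

end
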